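(* Let $\gamma\in(0,1/2)\setminus\mathbb Q$ and let $\ell>1$. No map $f\in\mathcal S_\gamma^\ell$ satisfies the Collet--Eckmann condition.
   Context: $\mathbb N$ is the set of positive integers, $\mathbb N_0=\mathbb N\cup\{0\}$, and $[a,b]$ denotes the closed interval with endpoints $a,b$ in whichever order. Unimodal map: a continuous noninjective map $f:I\to I$ of a compact interval $I$ with $f(\partial I)\subset\partial I$, having a unique turning point $c\in\mathrm{int}(I)$, which is a maximum: $f$ is strictly increasing to the left of $c$ and strictly decreasing to the right. Write $c_n=f^n(c)$. Standing normalization: $c_2<c<c_1$ and $c_2<c_3$. Kneading map: let $D_1=[c,c_1]$ and, for $n\ge2$, $D_n=f(D_{n-1})$ if $c\notin D_{n-1}$, $D_n=[c_n,c_1]$ if $c\in D_{n-1}$. An integer $n\ge1$ is a cutting time if $c\in D_n$; cutting times are enumerated as $1=S_0<S_1=2<S_2<\cdots$. The difference of consecutive cutting times is a cutting time, and the kneading map $Q:\mathbb N\to\mathbb N_0$ is defined by $S_k-S_{k-1}=S_{Q(k)}$. $S$-unimodal map of critical order $\ell>1$: a $C^1$ unimodal map which is $C^3$ away from $c$, whose unique critical point is $c$, such that (i) $c$ is non-flat of order $\ell$: there are $C^3$ diffeomorphisms $\phi,\psi$ of $\mathbb R$ with $\phi(c)=0=\psi(f(c))$ and $|\psi(f(x))|=|\phi(x)|^\ell$ near $c$; (ii) $f$ has negative Schwarzian derivative: $\frac{f'''(x)}{f'(x)}-\frac32\left(\frac{f''(x)}{f'(x)}\right)^2<0$ wherever $f'\ne0$.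 All $S$-unimodal maps are assumed to have no attracting or parabolic periodic orbit. For $\gamma\in(0,1/2)\setminus\mathbb Q$ put $\omega_\gamma=\gamma/(1-\gamma)$ and $Q_\gamma(k)=\lfloor k\omega_\gamma\rfloor-\lfloor(k-1)\omega_\gamma\rfloor$, $k\ge1$. $\mathcal S_\gamma$ is the set of unimodal maps with kneading map $Q_\gamma$, and $\mathcal S_\gamma^\ell$ is the set of $S$-unimodal maps of critical order $\ell$ in $\mathcal S_\gamma$. Collet--Eckmann condition: there exist constants $C>0$ and $\lambda>1$ such that $|Df^n(f(c))|\ge C\lambda^n$ for every $n\ge1$, where $Df^n$ is the derivative of $f^n$. *)

theory Defs
  imports "HOL-Analysis.Analysis"
begin

text \<open>
  An interval map is a function \<^term>\<open>f :: real \<Rightarrow> real\<close> together with the endpoints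
  \<^term>\<open>a\<close>, \<^term>\<open>b\<close> of its interval; values of \<^term>\<open>f\<close> outside \<^term>\<open>{a..b}\<close> play no role.
  Derivatives are therefore taken relative to the domain (one-sided at \<^term>\<open>a\<close> and \<^term>\<open>b\<close>).
\<close>

definition deriv_on :: "real set \<Rightarrow> (real \<Rightarrow> real) \<Rightarrow> real \<Rightarrow> real" where
  "deriv_on S f x = vector_derivative f (at x within S)"

definition Ck_on :: "nat \<Rightarrow> real set \<Rightarrow> (real \<Rightarrow> real) \<Rightarrow> bool" where
  "Ck_on k S f \<longleftrightarrow>
     (\<forall>j<k. (deriv_on S ^^ j) f differentiable_on S) \<and> continuous_on S ((deriv_on S ^^ k) f)"

definition Ck_diffeo :: "nat \<Rightarrow> (real \<Rightarrow> real) \<Rightarrow> bool" where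
  "Ck_diffeo k \<phi> \<longleftrightarrow> bij \<phi> \<and> Ck_on k UNIV \<phi> \<and> Ck_on k UNIV (inv \<phi>)"

definition unimodal :: "real \<Rightarrow> real \<Rightarrow> real \<Rightarrow> (real \<Rightarrow> real) \<Rightarrow> bool" where
  "unimodal a b c f \<longleftrightarrow>
     a < c \<and> c < b \<and>
     continuous_on {a..b} f \<and> f ` {a..b} \<subseteq> {a..b} \<and> \<not> inj_on f {a..b} \<and>
     f ` {a, b} \<subseteq> {a, b} \<and>
     strict_mono_on {a..c} f \<and> strict_antimono_on {c..b} f"

text \<open>The normalization \<open>c\<^sub>2 < c < c\<^sub>1\<close> and \<open>c\<^sub>2 < c\<^sub>3\<close>, where \<open>c\<^sub>n\<close> is the \<open>n\<close>-th iterate of \<open>c\<close>.\<close>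

definition normalized :: "real \<Rightarrow> (real \<Rightarrow> real) \<Rightarrow> bool" where
  "normalized c f \<longleftrightarrow>
     (f ^^ 2) c < c \<and> c < (f ^^ 1) c \<and> (f ^^ 2) c < (f ^^ 3) c"

text \<open>Indices start at 1; the value at 0 is a dummy.\<close>

fun D :: "real \<Rightarrow> (real \<Rightarrow> real) \<Rightarrow> nat \<Rightarrow> real set" where
  "D c f 0 = {}"
| "D c f (Suc 0) = closed_segment c (f c)"
| "D c f (Suc (Suc n)) =
     (if c \<in> D c f (Suc n) then closed_segment ((f ^^ Suc (Suc n)) c) (f c)
      else f ` D c f (Suc n))"

definition cutting_times :: "real \<Rightarrow> (real \<Rightarrow> real) \<Rightarrow> nat set" where
  "cutting_times c f = {n. n \<ge> 1 \<and> c \<in> D c f n}"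

definition cutting_time :: "real \<Rightarrow> (real \<Rightarrow> real) \<Rightarrow> nat \<Rightarrow> nat" where
  "cutting_time c f k = enumerate (cutting_times c f) k"

text \<open>
  A kneading map is defined on the positive integers, so only the values of \<^term>\<open>Q\<close> at
  \<open>k \<ge> 1\<close> are constrained. It is defined on all of them only if there are infinitely many
  cutting times.
\<close>

definition has_kneading_map :: "real \<Rightarrow> (real \<Rightarrow> real) \<Rightarrow> (nat \<Rightarrow> nat) \<Rightarrow> bool" where
  "has_kneading_map c f Q \<longleftrightarrow>
     infinite (cutting_times c f) \<and>
     (\<forall>k\<ge>1. cutting_time c f k - cutting_time c f (k - 1) = cutting_time c f (Q k))"

definition nonflat :: "real \<Rightarrow> real \<Rightarrow> (real \<Rightarrow> real) \<Rightarrow> bool" where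
  "nonflat l c f \<longleftrightarrow>
     (\<exists>\<phi> \<psi>. Ck_diffeo 3 \<phi> \<and> Ck_diffeo 3 \<psi> \<and> \<phi> c = 0 \<and> \<psi> (f c) = 0 \<and>
        (\<forall>\<^sub>F x in nhds c. \<bar>\<psi> (f x)\<bar> = \<bar>\<phi> x\<bar> powr l))"

definition schwarzian_on :: "real set \<Rightarrow> (real \<Rightarrow> real) \<Rightarrow> real \<Rightarrow> real" where
  "schwarzian_on S f x =
     (deriv_on S ^^ 3) f x / deriv_on S f x
       - 3 / 2 * ((deriv_on S ^^ 2) f x / deriv_on S f x)\<^sup>2"

definition attracting_periodic_point :: "real \<Rightarrow> real \<Rightarrow> (real \<Rightarrow> real) \<Rightarrow> real \<Rightarrow> bool" where
  "attracting_periodic_point a b f x \<longleftrightarrow>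
     x \<in> {a..b} \<and> (\<exists>p\<ge>1. (f ^^ p) x = x \<and> \<bar>deriv_on {a..b} (f ^^ p) x\<bar> < 1)"

definition parabolic_periodic_point :: "real \<Rightarrow> real \<Rightarrow> (real \<Rightarrow> real) \<Rightarrow> real \<Rightarrow> bool" where
  "parabolic_periodic_point a b f x \<longleftrightarrow>
     x \<in> {a..b} \<and> (\<exists>p\<ge>1. (f ^^ p) x = x \<and> \<bar>deriv_on {a..b} (f ^^ p) x\<bar> = 1)"

definition S_unimodal :: "real \<Rightarrow> real \<Rightarrow> real \<Rightarrow> real \<Rightarrow> (real \<Rightarrow> real) \<Rightarrow> bool" where
  "S_unimodal l a b c f \<longleftrightarrow>
     unimodal a b c f \<and>
     Ck_on 1 {a..b} f \<and>
     Ck_on 3 ({a..b} - {c}) f \<and>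
     (\<forall>x\<in>{a..b}. deriv_on {a..b} f x = 0 \<longleftrightarrow> x = c) \<and>
     nonflat l c f \<and>
     (\<forall>x\<in>{a..b} - {c}. deriv_on ({a..b} - {c}) f x \<noteq> 0 \<longrightarrow>
        schwarzian_on ({a..b} - {c}) f x < 0) \<and>
     (\<nexists>x. attracting_periodic_point a b f x) \<and>
     (\<nexists>x. parabolic_periodic_point a b f x)"

definition \<omega>_of :: "real \<Rightarrow> real" where
  "\<omega>_of \<gamma> = \<gamma> / (1 - \<gamma>)"

definition Q_of :: "real \<Rightarrow> nat \<Rightarrow> nat" where
  "Q_of \<gamma> k = nat (\<lfloor>real k * \<omega>_of \<gamma>\<rfloor> - \<lfloor>(real k - 1) * \<omega>_of \<gamma>\<rfloor>)"

text \<open>The classes below consist of the maps of \<^term>\<open>{a..b}\<close> with turning point \<^term>\<open>c\<close>.\<close>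

definition unimodal_class :: "real \<Rightarrow> real \<Rightarrow> real \<Rightarrow> real \<Rightarrow> (real \<Rightarrow> real) set" where
  "unimodal_class \<gamma> a b c =
     {f. unimodal a b c f \<and> normalized c f \<and> has_kneading_map c f (Q_of \<gamma>)}"

definition S_unimodal_class :: "real \<Rightarrow> real \<Rightarrow> real \<Rightarrow> real \<Rightarrow> real \<Rightarrow> (real \<Rightarrow> real) set" where
  "S_unimodal_class \<gamma> l a b c = {f \<in> unimodal_class \<gamma> a b c. S_unimodal l a b c f}"

definition collet_eckmann :: "real \<Rightarrow> real \<Rightarrow> real \<Rightarrow> (real \<Rightarrow> real) \<Rightarrow> bool" where
  "collet_eckmann a b c f \<longleftrightarrow>
     (\<exists>C>0. \<exists>r>1. \<forall>n\<ge>1. \<bar>deriv_on {a..b} (f ^^ n) (f c)\<bar> \<ge> C * r ^ n)"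

end

theory Submission
  imports Defs
begin

text \<open>
  Since \<open>Q = Q\<^sub>\<gamma>\<close> takes only the values 0 and 1, we have \<open>S\<^sub>k = S\<^bsub>k-1\<^esub> + 1 + Q(k)\<close>, and if \<open>Q(k) = 1\<close> and
  \<open>Q(k+i) = Q(i)\<close> for \<open>1 \<le> i \<le> j\<close>, then the itineraries of \<open>c\<^bsub>S\<^sub>k\<^esub>\<close> and \<open>c\<^sub>1\<close> agree for \<open>S\<^sub>j\<close> steps. The branch
  of \<open>f\<^bsup>S\<^sub>j-1\<^esup>\<close> on the left of \<open>c\<^sub>1\<close> extends beyond \<open>c\<close> to \<open>c\<^sub>1\<close> or \<open>c\<^sub>2\<close>, so negative Schwarzian derivative
  (a one-sided Koebe principle) gives \<open>c\<^sub>1 - c\<^bsub>S\<^sub>k\<^esub> \<le> K / |Df\<^bsup>S\<^sub>j-1\<^esup>(c\<^sub>1)|\<close>. Under the Collet--Eckmann condition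
  this is exponentially small in \<open>j\<close>, hence by non-flatness and \<open>\<ell> > 1\<close> so is \<open>|Df|\<close> at time \<open>S\<^sub>k - 1\<close>. Each \<open>k\<close>
  thus costs a factor exponential in its longest match \<open>j\<^sub>k\<close>. For a rotation the match length has infinite mean:
  \<open>\<Sum>\<^bsub>k\<le>N\<^esub> j\<^sub>k\<close> is not \<open>O(N)\<close>. So \<open>|Df\<^sup>n(c\<^sub>1)|\<close> with \<open>n = S\<^sub>N \<le> 2N + 1\<close> tends to 0 along a subsequence, a
  contradiction.
\<close>

section \<open>Prefix matches of the sequence \<open>Q\<^sub>\<gamma>\<close>\<close>

text \<open>This is \<open>1 - frac (real i * w)\<close>, the room above \<open>i w\<close> up to
  the next integer: the floor is additive on \<open>k w + i w\<close> exactly when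
  \<open>frac (real k * w)\<close> is smaller.\<close>

definition upper_gap :: "real \<Rightarrow> nat \<Rightarrow> real" where
  "upper_gap w i = of_int \<lfloor>real i * w\<rfloor> + 1 - real i * w"

text \<open>
  The fraction \<open>p/n\<close> with \<open>p = \<lfloor>n w\<rfloor> + 1\<close> beats all upper approximations of \<open>w\<close> with a smaller denominator.
  Then no integer lies in \<open>[k w, k p/n)\<close> for \<open>0 < k < n\<close>, so \<open>k w\<close> and \<open>k p/n\<close> have the same
  floor; this replaces continued fractions and equidistribution below.
\<close>

definition upper_record :: "real \<Rightarrow> nat \<Rightarrow> bool" where
  "upper_record w n \<longleftrightarrow> n \<ge> 1 \<and>
     (\<forall>i\<in>{1..<n}. (of_int \<lfloor>real n * w\<rfloor> + 1) / real n < (of_int \<lfloor>real i * w\<rfloor> + 1) / real i)"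

lemma upper_gap_pos: "upper_gap w i > 0"
  unfolding upper_gap_def by linarith

text \<open>The quotients \<open>V i\<close> exceed \<open>w\<close> and come arbitrarily close to
  it, so they eventually fall below their minimum over the first \<open>Suc m\<close> indices. The
  least index where this happens is a record beyond \<open>m\<close>.\<close>

lemma exists_upper_record: "\<exists>n>m. upper_record w n"
proof -
  define V where "V i = (of_int \<lfloor>real i * w\<rfloor> + 1) / real i" for i :: nat
  have V_gt: "V i > w" if "i \<ge> 1" for i
  proof -
    have "real i * w < of_int \<lfloor>real i * w\<rfloor> + 1" by linarith
    then show ?thesis using that by (simp add: V_def field_simps)
  qed
  have V_le: "V i \<le> w + 1 / real i" if "i \<ge> 1" for i
  proof -
    have "of_int \<lfloor>real i * w\<rfloor> + 1 \<le> real i * w + 1" by linarith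
    then show ?thesis using that by (simp add: V_def field_simps)
  qed
  define v where "v = Min (V ` {1..Suc m})"
  have "v \<in> V ` {1..Suc m}" unfolding v_def by (intro Min_in) auto
  then have "v > w" using V_gt by auto
  have v_le: "v \<le> V i" if "i \<in> {1..Suc m}" for i
    unfolding v_def using that by (intro Min_le) auto
  obtain n0 :: nat where n0: "n0 > 0" "1 / real n0 < v - w"
    using \<open>v > w\<close> by (metis diff_gt_0_iff_gt inverse_eq_divide reals_Archimedean zero_less_Suc)
  define P where "P n \<longleftrightarrow> n \<ge> 1 \<and> V n < v" for n
  have "P n0" unfolding P_def using V_le[of n0] n0 by auto
  define n where "n = (LEAST n. P n)"
  have "P n" unfolding n_def by (rule LeastI) fact
  have least: "\<not> P i" if "i < n" for i using that not_less_Least unfolding n_def by blast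
  have "n > m"
  proof (rule ccontr)
    assume "\<not> n > m"
    then show False using v_le[of n] \<open>P n\<close> unfolding P_def by auto
  qed
  moreover have "upper_record w n"
    unfolding upper_record_def
  proof (intro conjI ballI)
    show "n \<ge> 1" using \<open>P n\<close> P_def by auto
    fix i assume i: "i \<in> {1..<n}"
    then have "v \<le> V i" using least[of i] unfolding P_def by auto
    then show "(of_int \<lfloor>real n * w\<rfloor> + 1) / real n < (of_int \<lfloor>real i * w\<rfloor> + 1) / real i"
      using \<open>P n\<close> unfolding P_def V_def by auto
  qed
  ultimately show ?thesis by blast
qed

text \<open>Cleared of denominators, the record inequality is strict between integers and so gains
  1. Replacing \<open>p/n\<close> by the smaller \<open>w\<close> then bounds the gap.\<close>

lemma upper_record_gap:
  assumes "upper_record w n" "1 \<le> i" "i < n"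
  shows "int n * (\<lfloor>real i * w\<rfloor> + 1) - int i * (\<lfloor>real n * w\<rfloor> + 1) \<ge> 1"
    and "upper_gap w i \<ge> 1 / real n"
proof -
  have "(of_int \<lfloor>real n * w\<rfloor> + 1) / real n < (of_int \<lfloor>real i * w\<rfloor> + 1) / real i"
    using assms unfolding upper_record_def by auto
  then have "real i * (of_int \<lfloor>real n * w\<rfloor> + 1) < real n * (of_int \<lfloor>real i * w\<rfloor> + 1)"
    using assms by (simp add: divide_simps mult.commute)
  then have "real_of_int (int i * (\<lfloor>real n * w\<rfloor> + 1)) < real_of_int (int n * (\<lfloor>real i * w\<rfloor> + 1))"
    by simp
  then show 1: "int n * (\<lfloor>real i * w\<rfloor> + 1) - int i * (\<lfloor>real n * w\<rfloor> + 1) \<ge> 1"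
    by linarith
  then have 2: "real n * (of_int \<lfloor>real i * w\<rfloor> + 1) - real i * (of_int \<lfloor>real n * w\<rfloor> + 1) \<ge> 1"
    by (metis (mono_tags) of_int_1 of_int_add of_int_diff of_int_le_iff of_int_mult of_int_of_nat_eq)
  have "real n * w \<le> of_int \<lfloor>real n * w\<rfloor> + 1" by linarith
  then have "real i * (real n * w) \<le> real i * (of_int \<lfloor>real n * w\<rfloor> + 1)"
    by (intro mult_left_mono) auto
  with 2 have "1 \<le> real n * upper_gap w i"
    unfolding upper_gap_def by (simp add: algebra_simps)
  then show "upper_gap w i \<ge> 1 / real n"
    using assms by (simp add: divide_simps mult.commute)
qed

text \<open>At a record denominator a lower equidistribution bound holds with error 1. Replacing
  \<open>w\<close> by \<open>p/n\<close> turns fractional parts into residues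
  \<open>k p mod n\<close>, which run once through \<open>1..n-1\<close>. It also increases them, so
  a residue of at most \<open>n d\<close> forces \<open>frac (real k * w) < d\<close>.\<close>

lemma upper_record_frac_count:
  assumes rec: "upper_record w n" and d: "0 < d" "d \<le> 1"
  shows "real (card {k\<in>{1..<n}. frac (real k * w) < d}) \<ge> real n * d - 1"
proof -
  define p where "p = \<lfloor>real n * w\<rfloor> + 1"
  define h where "h k = (int k * p) mod int n" for k :: nat
  have n: "n \<ge> 1" using rec unfolding upper_record_def by auto
  have pgt: "real n * w < of_int p" unfolding p_def by linarith
  have divk: "(int k * p) div int n = \<lfloor>real k * w\<rfloor>" and nz: "h k \<noteq> 0" if k: "k \<in> {1..<n}" for k
  proof -
    have up: "int k * p < int n * (\<lfloor>real k * w\<rfloor> + 1)"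
      using upper_record_gap(1)[OF rec, of k] k unfolding p_def by auto
    have "real n * (real k * w) < real k * of_int p"
      using mult_strict_left_mono[OF pgt, of "real k"] k by (simp add: mult.left_commute)
    moreover have "real n * of_int \<lfloor>real k * w\<rfloor> \<le> real n * (real k * w)"
      by (intro mult_left_mono) auto
    ultimately have "real_of_int (int n * \<lfloor>real k * w\<rfloor>) < real_of_int (int k * p)"
      by simp
    then have lo: "int n * \<lfloor>real k * w\<rfloor> < int k * p" by linarith
    define r where "r = int k * p - int n * \<lfloor>real k * w\<rfloor>"
    have r: "0 < r" "r < int n" using lo up unfolding r_def by (auto simp: algebra_simps)
    have eq: "int k * p = r + int n * \<lfloor>real k * w\<rfloor>" unfolding r_def by simp
    show "(int k * p) div int n = \<lfloor>real k * w\<rfloor>"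
      unfolding eq using r by simp
    show "h k \<noteq> 0" unfolding h_def eq using r by simp
  qed
  have frac_lt: "frac (real k * w) < of_int (h k) / real n" if k: "k \<in> {1..<n}" for k
  proof -
    have "int k * p = int n * \<lfloor>real k * w\<rfloor> + h k"
      using divk[OF k] unfolding h_def by (metis mult_div_mod_eq)
    then have "real k * of_int p = real n * of_int \<lfloor>real k * w\<rfloor> + of_int (h k)"
      by (metis of_int_add of_int_mult of_int_of_nat_eq)
    moreover have "real k * (real n * w) < real k * of_int p"
      using mult_strict_left_mono[OF pgt, of "real k"] k by simp
    ultimately have "real n * frac (real k * w) < of_int (h k)"
      unfolding frac_def by (simp add: algebra_simps)
    then show ?thesis using n by (simp add: field_simps)
  qed
  \<comment> \<open>Equal residues would make the residue of the difference vanish;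
    \<open>nz\<close> does the work of coprimality of \<open>p\<close> and \<open>n\<close>.\<close>
  have inj: "inj_on h {1..<n}"
  proof (rule linorder_inj_onI)
    fix x y assume xy: "x < y" "x \<in> {1..<n}" "y \<in> {1..<n}"
    show "h x \<noteq> h y"
    proof
      assume "h x = h y"
      then have "int n dvd int y * p - int x * p" unfolding h_def by (metis mod_eq_dvd_iff)
      then have "h (y - x) = 0" unfolding h_def using xy by (simp add: of_nat_diff left_diff_distrib)
      moreover have "y - x \<in> {1..<n}" using xy unfolding atLeastLessThan_iff by linarith
      ultimately show False using nz[of "y - x"] by blast
    qed
  qed auto
  have "h ` {1..<n} \<subseteq> {1..<int n}"
  proof
    fix y assume "y \<in> h ` {1..<n}"
    then obtain k where k: "k \<in> {1..<n}" "y = h k" by auto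
    have "0 \<le> h k" "h k < int n" using n unfolding h_def by simp_all
    moreover have "h k \<noteq> 0" using nz k(1) by blast
    ultimately show "y \<in> {1..<int n}" unfolding k(2) by simp
  qed
  then have surj: "h ` {1..<n} = {1..<int n}"
  proof (intro card_subset_eq)
    have "card (h ` {1..<n}) = n - 1" using card_image[OF inj] by simp
    also have "n - 1 = card {1..<int n}" using n by (simp add: nat_diff_distrib)
    finally show "card (h ` {1..<n}) = card {1..<int n}" .
  qed auto
  \<comment> \<open>The cap \<open>n - 1\<close> matters only for \<open>d = 1\<close>, where the
    floor is \<open>n\<close> but no residue is.\<close>
  define m where "m = min \<lfloor>real n * d\<rfloor> (int n - 1)"
  have "{1..m} \<subseteq> h ` {k\<in>{1..<n}. frac (real k * w) < d}"
  proof
    fix s assume s: "s \<in> {1..m}"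
    then have "s \<in> h ` {1..<n}" unfolding surj m_def by simp
    then obtain k where k: "k \<in> {1..<n}" "s = h k" by blast
    have "s \<le> \<lfloor>real n * d\<rfloor>" using s unfolding m_def by simp
    then have "of_int s \<le> real n * d" by (simp only: le_floor_iff)
    then have "of_int (h k) / real n \<le> d" unfolding k(2) using n by (simp add: divide_le_eq mult.commute)
    then have "frac (real k * w) < d" using frac_lt[OF k(1)] by linarith
    then show "s \<in> h ` {k\<in>{1..<n}. frac (real k * w) < d}" using k by blast
  qed
  then have le: "card {1..m} \<le> card {k\<in>{1..<n}. frac (real k * w) < d}"
    by (intro surj_card_le[of _ _ h]) auto
  have "real n * d - 1 \<le> real_of_int m"
  proof -
    have "real n * d \<le> real n" using d n by simp
    moreover have "real_of_int \<lfloor>real n * d\<rfloor> \<ge> real n * d - 1" by linarith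
    ultimately show ?thesis unfolding m_def of_int_min by simp
  qed
  also have "\<dots> \<le> real (nat m)" by linarith
  also have "\<dots> = real (card {1..m})" unfolding card_atLeastAtMost_int by simp
  also have "\<dots> \<le> real (card {k\<in>{1..<n}. frac (real k * w) < d})"
    using le by (rule of_nat_mono)
  finally show ?thesis .
qed

section \<open>Prefix matches and their average length\<close>

text \<open>For the maps considered, \<open>q k = 1\<close> puts \<open>(f ^^ S k) c\<close> to the
  right of \<open>c\<close>, where \<open>f c\<close> lies. The admissible \<open>j\<close> form an
  initial segment, so counting them measures the match length.\<close>

definition prefix_match :: "(nat \<Rightarrow> nat) \<Rightarrow> nat \<Rightarrow> nat \<Rightarrow> bool" where
  "prefix_match q k j \<longleftrightarrow> q k = 1 \<and> (\<forall>i\<in>{1..j}. q (k + i) = q i)"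

text \<open>The bound \<open>frac (real k * w) < w\<close> says that the last step crossed an
  integer, so the value at \<open>k\<close> is 1. The gap conditions make the floor additive, and
  \<open>Q_of\<close> is a difference of consecutive floors.\<close>

lemma Q_of_match:
  assumes w: "w = \<omega>_of \<gamma>" "0 < w" "w < 1"
    and k: "k \<ge> 1" and lt: "frac (real k * w) < w"
    and gap: "\<And>i. i \<in> {1..j} \<Longrightarrow> frac (real k * w) < upper_gap w i"
  shows "prefix_match (Q_of \<gamma>) k j"
proof -
  have fl: "\<lfloor>real (k + i) * w\<rfloor> = \<lfloor>real k * w\<rfloor> + \<lfloor>real i * w\<rfloor>" if "i \<le> j" for i
  proof (cases "i = 0")
    case False
    define x y where "x = real k * w" and "y = real i * w"
    have "frac x < of_int \<lfloor>y\<rfloor> + 1 - y"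
      using gap[of i] False that unfolding upper_gap_def x_def y_def by auto
    then have "\<lfloor>x + y\<rfloor> = \<lfloor>x\<rfloor> + \<lfloor>y\<rfloor>"
      unfolding frac_def by (intro floor_unique) (simp_all add: add_mono)
    moreover have "real (k + i) * w = x + y" unfolding x_def y_def by (simp add: distrib_right)
    ultimately show ?thesis unfolding x_def y_def by simp
  qed auto
  have "\<lfloor>(real k - 1) * w\<rfloor> = \<lfloor>real k * w\<rfloor> - 1"
  proof -
    define x where "x = real k * w"
    have "\<lfloor>x - w\<rfloor> = m - 1" if "x - w < of_int m" "of_int m \<le> x" for m
      using that w(3) by (intro floor_unique) simp_all
    moreover have "x - w < of_int \<lfloor>x\<rfloor>" "of_int \<lfloor>x\<rfloor> \<le> x"
      using lt unfolding frac_def x_def by simp_all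
    ultimately have "\<lfloor>x - w\<rfloor> = \<lfloor>x\<rfloor> - 1" by blast
    moreover have "(real k - 1) * w = x - w" unfolding x_def by (simp add: left_diff_distrib)
    ultimately show ?thesis unfolding x_def by simp
  qed
  then have "Q_of \<gamma> k = 1" unfolding Q_of_def w(1)[symmetric] by simp
  moreover have "Q_of \<gamma> (k + i) = Q_of \<gamma> i" if i: "i \<in> {1..j}" for i
  proof -
    obtain i' where i': "i = Suc i'" using i by (cases i) auto
    have eqs: "real (k + i) - 1 = real (k + i')" "real i - 1 = real i'" unfolding i' by simp_all
    have le: "i \<le> j" "i' \<le> j" using i i' by simp_all
    show ?thesis unfolding Q_of_def w(1)[symmetric] eqs fl[OF le(1)] fl[OF le(2)] by simp
  qed
  ultimately show ?thesis unfolding prefix_match_def by blast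
qed

text \<open>Threshold for \<open>frac (real k * w)\<close> below which \<open>Q_of_match\<close>
  yields a match of length \<open>j\<close>; the inserted \<open>w\<close> takes care of
  \<open>q k = 1\<close>. It serves as a lower bound for the frequency of such
  \<open>k\<close>.\<close>

definition min_gap :: "real \<Rightarrow> nat \<Rightarrow> real" where
  "min_gap w j = Min (insert w (upper_gap w ` {1..j}))"

lemma min_gap_pos: "w > 0 \<Longrightarrow> min_gap w j > 0"
  unfolding min_gap_def by (subst Min_gr_iff) (auto simp: upper_gap_pos)

lemma min_gap_le:
  shows "min_gap w j \<le> w" and "i \<in> {1..j} \<Longrightarrow> min_gap w j \<le> upper_gap w i"
  unfolding min_gap_def by (rule Min_le, simp, simp)+

lemma min_gap_antimono: "i \<le> j \<Longrightarrow> min_gap w j \<le> min_gap w i"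
  unfolding min_gap_def by (intro Min_antimono) auto

lemma min_gap_record:
  assumes "upper_record w n" "0 < w" "w < 1"
  shows "min_gap w (n - 1) \<ge> w / real n"
proof -
  have n: "n \<ge> 1" using assms unfolding upper_record_def by auto
  have "w / real n \<le> w" using assms n by (simp add: field_simps)
  moreover have "w / real n \<le> upper_gap w i" if i: "i \<in> {1..n-1}" for i
  proof -
    have "w / real n \<le> 1 / real n" using assms n by (simp add: field_simps)
    also have "\<dots> \<le> upper_gap w i" using i by (intro upper_record_gap(2)[OF assms(1)]) auto
    finally show ?thesis .
  qed
  ultimately show ?thesis unfolding min_gap_def by (subst Min_ge_iff) auto
qed

text \<open>The terms before a record \<open>n\<close> are at least \<open>w / n\<close>. If
  \<open>n\<close> exceeds \<open>2 * J + 2\<close>, at least \<open>n / 2\<close> of them come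
  after \<open>J\<close> and contribute \<open>w / 2\<close>. As there are records beyond any bound,
  this repeats, as for the harmonic series.\<close>

lemma min_gap_sum_unbounded:
  assumes w: "0 < w" "w < 1"
  shows "\<exists>J. (\<Sum>j=1..J. min_gap w j) \<ge> B"
proof -
  have "\<exists>J. (\<Sum>j=1..J. min_gap w j) \<ge> real m * (w / 2)" for m :: nat
  proof (induction m)
    case (Suc m)
    then obtain J where J: "(\<Sum>j=1..J. min_gap w j) \<ge> real m * (w / 2)" by blast
    obtain n where n: "n > 2 * J + 2" "upper_record w n" using exists_upper_record by blast
    have "real n / 2 \<le> real (n - 1 - J)" using n by (simp add: of_nat_diff)
    then have "real n / 2 * (w / real n) \<le> real (n - 1 - J) * (w / real n)"
      using w by (intro mult_right_mono) auto
    then have "w / 2 \<le> (\<Sum>j=Suc J..n - 1. w / real n)" using n by simp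
    also have "\<dots> \<le> (\<Sum>j=Suc J..n - 1. min_gap w j)"
    proof (intro sum_mono)
      fix j assume "j \<in> {Suc J..n-1}"
      then show "w / real n \<le> min_gap w j"
        using min_gap_record[OF n(2) w] min_gap_antimono[of j "n-1" w] by auto
    qed
    finally have "w / 2 \<le> (\<Sum>j=Suc J..n - 1. min_gap w j)" .
    moreover have "(\<Sum>j=1..n-1. min_gap w j) = (\<Sum>j=1..J. min_gap w j) + (\<Sum>j=Suc J..n - 1. min_gap w j)"
      using n sum.ub_add_nat[of 1 J "min_gap w" "n - 1 - J"] by simp
    ultimately show ?case using J by (intro exI[of _ "n-1"]) (simp add: algebra_simps)
  qed (auto intro!: exI[of _ 0])
  moreover obtain m :: nat where "B / (w / 2) \<le> real m" using real_arch_simple by blast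
  then have "B \<le> real m * (w / 2)" using w by (simp add: field_simps)
  ultimately show ?thesis by (meson order_trans)
qed

text \<open>Counting pairs \<open>(k, j)\<close> by \<open>j\<close> instead of \<open>k\<close>
  turns the mean match length into a sum of frequencies, bounded below by the divergent sum of
  \<open>min_gap\<close>. Truncating at a \<open>J\<close> fixed before \<open>N\<close> keeps the
  counting error bounded.\<close>

lemma prefix_match_sum_superlinear:
  assumes w: "w = \<omega>_of \<gamma>" "0 < w" "w < 1"
  shows "\<exists>J. \<forall>N0. \<exists>N\<ge>N0.
    (\<Sum>k=1..N. real (card {j\<in>{1..J}. prefix_match (Q_of \<gamma>) k j})) \<ge> B * real N"
proof -
  \<comment> \<open>The extra 1 in \<open>B + 1\<close> absorbs the error \<open>real J\<close>,
    since the record \<open>n\<close> is taken larger than \<open>J\<close>.\<close>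
  obtain J where J: "(\<Sum>j=1..J. min_gap w j) \<ge> B + 1"
    using min_gap_sum_unbounded[OF w(2,3)] by blast
  show ?thesis
  proof (rule exI[of _ J], rule allI)
    fix N0
    obtain n where n: "n > max N0 J" "upper_record w n" using exists_upper_record by blast
    have "(\<Sum>k=1..n. real (card {j\<in>{1..J}. prefix_match (Q_of \<gamma>) k j}))
        = real (\<Sum>k=1..n. \<Sum>j=1..J. if prefix_match (Q_of \<gamma>) k j then 1 else 0)"
      by (simp add: sum.If_cases Int_def conj_commute)
    also have "\<dots> = real (\<Sum>j=1..J. \<Sum>k=1..n. if prefix_match (Q_of \<gamma>) k j then 1 else 0)"
      by (subst sum.swap) simp
    also have "\<dots> = (\<Sum>j=1..J. real (card {k\<in>{1..n}. prefix_match (Q_of \<gamma>) k j}))"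
      by (simp add: sum.If_cases Int_def conj_commute)
    also have "\<dots> \<ge> (\<Sum>j=1..J. real n * min_gap w j - 1)"
    proof (intro sum_mono)
      fix j assume "j \<in> {1..J}"
      have "real n * min_gap w j - 1 \<le> real (card {k\<in>{1..<n}. frac (real k * w) < min_gap w j})"
        using min_gap_le(1)[of w j] w min_gap_pos[of w j] by (intro upper_record_frac_count n) auto
      also have "\<dots> \<le> real (card {k\<in>{1..n}. prefix_match (Q_of \<gamma>) k j})"
      proof (intro of_nat_mono card_mono subsetI)
        fix k assume k: "k \<in> {k\<in>{1..<n}. frac (real k * w) < min_gap w j}"
        then have "prefix_match (Q_of \<gamma>) k j"
          by (intro Q_of_match[OF w]) (auto intro: less_le_trans[OF _ min_gap_le(1)] less_le_trans[OF _ min_gap_le(2)])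
        then show "k \<in> {k\<in>{1..n}. prefix_match (Q_of \<gamma>) k j}" using k by auto
      qed auto
      finally show "real n * min_gap w j - 1 \<le> real (card {k\<in>{1..n}. prefix_match (Q_of \<gamma>) k j})" .
    qed
    also have "(\<Sum>j=1..J. real n * min_gap w j - 1) = real n * (\<Sum>j=1..J. min_gap w j) - real J"
      by (simp add: sum_subtractf sum_distrib_left)
    finally have "(\<Sum>k=1..n. real (card {j\<in>{1..J}. prefix_match (Q_of \<gamma>) k j}))
        \<ge> real n * (\<Sum>j=1..J. min_gap w j) - real J" .
    moreover have "(B + 1) * real n \<le> real n * (\<Sum>j=1..J. min_gap w j)"
      using J mult_right_mono[of "B + 1" "\<Sum>j=1..J. min_gap w j" "real n"] by (simp only: mult.commute)
    moreover have "real J \<le> real n" using n by simp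
    ultimately have "(\<Sum>k=1..n. real (card {j\<in>{1..J}. prefix_match (Q_of \<gamma>) k j})) \<ge> B * real n"
      unfolding distrib_right by linarith
    then show "\<exists>N\<ge>N0. (\<Sum>k=1..N. real (card {j\<in>{1..J}. prefix_match (Q_of \<gamma>) k j})) \<ge> B * real N"
      using n by (intro exI[of _ n]) simp
  qed
qed

section \<open>Negative Schwarzian derivative\<close>

text \<open>Equality holds for Moebius maps. The product form multiplies along an orbit, so the
  Schwarzian derivative of an iterate never has to be computed.\<close>

lemma negative_schwarzian_two_point:
  fixes f f1 f2 f3 :: "real \<Rightarrow> real"
  assumes xy: "x < y"
    and d1: "\<And>s. s \<in> {x..y} \<Longrightarrow> (f has_real_derivative f1 s) (at s)"
    and d2: "\<And>s. s \<in> {x..y} \<Longrightarrow> (f1 has_real_derivative f2 s) (at s)"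
    and d3: "\<And>s. s \<in> {x..y} \<Longrightarrow> (f2 has_real_derivative f3 s) (at s)"
    and pos: "\<And>s. s \<in> {x..y} \<Longrightarrow> f1 s > 0"
    and neg: "\<And>s. s \<in> {x..y} \<Longrightarrow> f3 s / f1 s - 3 / 2 * (f2 s / f1 s)\<^sup>2 < 0"
  shows "(y - x)\<^sup>2 * (f1 x * f1 y) \<le> (f y - f x)\<^sup>2"
proof -
  \<comment> \<open>negative Schwarzian derivative means that \<open>h\<close> is convex\<close>
  define h where "h s = f1 s powr (-1/2)" for s
  define h' where "h' s = -1/2 * f1 s powr (-3/2) * f2 s" for s
  define h'' where "h'' s = 3/4 * f1 s powr (-5/2) * (f2 s)\<^sup>2 - 1/2 * f1 s powr (-3/2) * f3 s" for s
  have conv: "convex_on {x..y} h"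
  proof (rule f''_ge0_imp_convex)
    fix s assume s: "s \<in> {x..y}"
    show "(h has_real_derivative h' s) (at s)"
      unfolding h_def[abs_def] h'_def
      by (rule derivative_eq_intros d2[OF s] pos[OF s] refl | simp)+
    show "(h' has_real_derivative h'' s) (at s)"
      unfolding h'_def[abs_def] h''_def
      by (rule derivative_eq_intros d2[OF s] d3[OF s] pos[OF s] refl | simp)+
         (simp add: power2_eq_square mult_ac)
    have p1: "f1 s powr (-3/2) = f1 s powr (-5/2) * f1 s"
      using pos[OF s] powr_add[of "f1 s" "-5/2" 1] by simp
    have "h'' s = -1/2 * f1 s powr (-5/2) * (f1 s)\<^sup>2 * (f3 s / f1 s - 3 / 2 * (f2 s / f1 s)\<^sup>2)"
      unfolding h''_def p1 using pos[OF s] by (simp add: field_simps power2_eq_square)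
    also have "\<dots> \<ge> 0" using neg[OF s] pos[OF s] by (simp add: mult_le_0_iff zero_le_mult_iff)
    finally show "h'' s \<ge> 0" .
  qed simp
  have hpos: "h s > 0" if "s \<in> {x..y}" for s using pos[OF that] unfolding h_def by simp
  have hsq: "f1 s * (h s)\<^sup>2 = 1" if "s \<in> {x..y}" for s
  proof -
    have "(h s)\<^sup>2 = f1 s powr (-1)"
      unfolding h_def power2_eq_square by (subst powr_add[symmetric]) simp
    then show ?thesis using pos[OF that] by (simp add: powr_minus_divide)
  qed
  define L where "L s = (y - s) * h x + (s - x) * h y" for s
  have Lpos: "L s > 0" if "s \<in> {x..y}" for s
  proof (cases "s = y")
    case True then show ?thesis using hpos[of y] xy unfolding L_def by simp
  next
    case False
    then have "(y - s) * h x > 0" "(s - x) * h y \<ge> 0" using hpos[of x] hpos[of y] that xy by auto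
    then show ?thesis unfolding L_def by linarith
  qed
  have hle: "h s * (y - x) \<le> L s" if "s \<in> {x..y}" for s
  proof -
    have "h s \<le> (h y - h x) / (y - x) * (s - x) + h x"
      using convex_onD_Icc'[OF conv that] .
    then have "h s * (y - x) \<le> ((h y - h x) / (y - x) * (s - x) + h x) * (y - x)"
      using xy by (intro mult_right_mono) auto
    also have "\<dots> = L s" unfolding L_def using xy by (simp add: field_simps)
    finally show ?thesis .
  qed
  \<comment> \<open>the Moebius map with derivative \<open>(y - x)\<^sup>2 / (L s)\<^sup>2\<close>, the value of \<open>f1\<close> if \<open>h\<close> were affine\<close>
  define m where "m s = (s - x) * (y - x) / (h x * L s)" for s
  have "f x - m x \<le> f y - m y"
  proof (rule DERIV_nonneg_imp_nondecreasing[of x y "\<lambda>s. f s - m s"])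
    fix s assume "x \<le> s" "s \<le> y"
    then have s: "s \<in> {x..y}" by simp
    have hx: "h x > 0" using hpos[of x] xy by simp
    have "(m has_real_derivative (y - x)\<^sup>2 / (L s)\<^sup>2) (at s)"
      unfolding m_def[abs_def] L_def[abs_def]
      apply (rule derivative_eq_intros refl)+
      using Lpos[OF s] hx unfolding L_def
      by (auto simp: divide_simps power2_eq_square) (simp add: algebra_simps)
    then have "((\<lambda>s. f s - m s) has_real_derivative f1 s - (y - x)\<^sup>2 / (L s)\<^sup>2) (at s)"
      by (intro DERIV_diff d1[OF s])
    moreover have "(y - x)\<^sup>2 / (L s)\<^sup>2 \<le> f1 s"
    proof -
      have "(h s * (y - x))\<^sup>2 \<le> (L s)\<^sup>2" using hle[OF s] hpos[OF s] xy by (intro power_mono) auto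
      then have "f1 s * (h s * (y - x))\<^sup>2 \<le> f1 s * (L s)\<^sup>2"
        using pos[OF s] by (intro mult_left_mono) auto
      moreover have "f1 s * (h s * (y - x))\<^sup>2 = (f1 s * (h s)\<^sup>2) * (y - x)\<^sup>2"
        by (simp add: power_mult_distrib)
      ultimately have "(y - x)\<^sup>2 \<le> f1 s * (L s)\<^sup>2" using hsq[OF s] by simp
      then show ?thesis using Lpos[OF s] by (simp add: divide_simps)
    qed
    ultimately show "\<exists>z. ((\<lambda>s. f s - m s) has_real_derivative z) (at s) \<and> 0 \<le> z" by force
  qed (use xy in simp)
  moreover have "m x = 0" unfolding m_def by simp
  moreover have "m y = (y - x) / (h x * h y)"
    unfolding m_def L_def using xy hpos[of x] hpos[of y] by (simp add: field_simps)
  ultimately have le: "(y - x) / (h x * h y) \<le> f y - f x" by simp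
  have "(y - x)\<^sup>2 * (f1 x * f1 y) = ((y - x) / (h x * h y))\<^sup>2 * ((f1 x * (h x)\<^sup>2) * (f1 y * (h y)\<^sup>2))"
    using hpos[of x] hpos[of y] xy by (simp add: field_simps power2_eq_square)
  also have "\<dots> = ((y - x) / (h x * h y))\<^sup>2" using hsq[of x] hsq[of y] xy by simp
  also have "\<dots> \<le> (f y - f x)\<^sup>2"
    using le hpos[of x] hpos[of y] xy by (intro power_mono) auto
  finally show ?thesis .
qed

text \<open>In the application \<open>m\<close> is the absolute derivative at \<open>w\<close>. The
  two-point bound says that \<open>1 / (g w - g s)\<close> grows no faster than
  \<open>1 / (m * (w - s))\<close>; comparing the growth from \<open>x\<close> to \<open>y\<close>
  and dropping a positive term at \<open>x\<close> gives the estimate.\<close>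

lemma one_sided_koebe:
  fixes g g' :: "real \<Rightarrow> real"
  assumes xyw: "x \<le> y" "y < w" and m: "m > 0"
    and d: "\<And>s. s \<in> {x..y} \<Longrightarrow> (g has_real_derivative g' s) (at s)"
    and less: "\<And>s. s \<in> {x..y} \<Longrightarrow> g s < g w"
    and two_point: "\<And>s. s \<in> {x..y} \<Longrightarrow> (w - s)\<^sup>2 * (\<bar>g' s\<bar> * m) \<le> (g w - g s)\<^sup>2"
  shows "(w - y) * m * (g y - g x) \<le> (g w - g x) * (g w - g y)"
proof -
  define u where "u s = 1 / (g w - g s) - 1 / (m * (w - s))" for s
  have "u y \<le> u x"
  proof (rule DERIV_nonpos_imp_nonincreasing[OF xyw(1)])
    fix s assume "x \<le> s" "s \<le> y"
    then have s: "s \<in> {x..y}" "s < w" using xyw by auto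
    have "((\<lambda>s. 1 / (g w - g s)) has_real_derivative g' s / (g w - g s)\<^sup>2) (at s)"
      using less[OF s(1)] by (auto intro!: derivative_eq_intros d[OF s(1)] simp: power2_eq_square)
    moreover have "((\<lambda>s. 1 / (m * (w - s))) has_real_derivative 1 / (m * (w - s)\<^sup>2)) (at s)"
      using s m by (auto intro!: derivative_eq_intros simp: power2_eq_square divide_simps)
    ultimately have "(u has_real_derivative g' s / (g w - g s)\<^sup>2 - 1 / (m * (w - s)\<^sup>2)) (at s)"
      unfolding u_def[abs_def] by (rule DERIV_diff)
    moreover have "g' s / (g w - g s)\<^sup>2 \<le> 1 / (m * (w - s)\<^sup>2)"
    proof -
      have "(w - s)\<^sup>2 * (g' s * m) \<le> (w - s)\<^sup>2 * (\<bar>g' s\<bar> * m)"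
        using m by (intro mult_left_mono mult_right_mono) auto
      also have "\<dots> \<le> (g w - g s)\<^sup>2" by (rule two_point[OF s(1)])
      finally show ?thesis using less[OF s(1)] s m by (simp add: divide_simps mult_ac)
    qed
    ultimately show "\<exists>z. (u has_real_derivative z) (at s) \<and> z \<le> 0" by force
  qed
  moreover have "1 / (m * (w - x)) > 0" using xyw m by simp
  ultimately have "1 / (g w - g y) - 1 / (g w - g x) \<le> 1 / (m * (w - y))"
    unfolding u_def by linarith
  moreover have "g w - g y > 0" "g w - g x > 0" "m * (w - y) > 0" using less xyw m by auto
  ultimately show ?thesis
    by (simp add: divide_simps mult_ac split: if_splits)
qed

lemma differentiable_on_has_deriv_on:
  assumes "g differentiable_on S" "x \<in> interior S"
  shows "(g has_real_derivative deriv_on S g x) (at x)"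
proof -
  have "x \<in> S" using assms(2) interior_subset by blast
  then have "g differentiable (at x within S)"
    using assms(1) unfolding differentiable_on_def by blast
  then have "(g has_vector_derivative deriv_on S g x) (at x within S)"
    unfolding deriv_on_def by (rule vector_derivative_works[THEN iffD1])
  then show ?thesis
    using at_within_interior[OF assms(2)]
    by (simp add: has_real_derivative_iff_has_vector_derivative)
qed

section \<open>Monotone branches of S-unimodal maps\<close>

locale S_unimodal_map =
  fixes l a b c :: real and f :: "real \<Rightarrow> real"
  assumes l_gt_1: "l > 1" and S_unimodal: "S_unimodal l a b c f" and normalized: "normalized c f"
begin

lemma unimodal: "unimodal a b c f"
  using S_unimodal unfolding S_unimodal_def by blast

lemma turning_point: "a < c" "c < b"
  and continuous: "continuous_on {a..b} f"
  and maps: "x \<in> {a..b} \<Longrightarrow> f x \<in> {a..b}"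
  and increasing: "strict_mono_on {a..c} f"
  and decreasing: "strict_antimono_on {c..b} f"
  and boundary: "f a \<in> {a, b}" "f b \<in> {a, b}"
  using unimodal unfolding unimodal_def by blast+

lemma f_less_left: "a \<le> x \<Longrightarrow> x < y \<Longrightarrow> y \<le> c \<Longrightarrow> f x < f y"
  using increasing unfolding monotone_on_def by auto

lemma f_less_right: "c \<le> x \<Longrightarrow> x < y \<Longrightarrow> y \<le> b \<Longrightarrow> f y < f x"
  using decreasing unfolding monotone_on_def by auto

lemma f_less_max: "x \<in> {a..b} \<Longrightarrow> x \<noteq> c \<Longrightarrow> f x < f c"
  using f_less_left[of x c] f_less_right[of c x] by (cases "x < c") auto

lemma f_endpoints: "f a = a" "f b = a"
  using boundary f_less_max[of a] f_less_max[of b] maps[of c] turning_point by auto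

lemma critical_orbit_order: "f (f c) < c" "c < f c" "f (f c) < f (f (f c))"
  using normalized unfolding normalized_def by (auto simp: numeral_2_eq_2 numeral_3_eq_3)

text \<open>Otherwise the critical orbit would land on the fixed endpoint \<open>a\<close>, against
  the strict inequality between its second and third points. Hence the open interval is invariant
  and two-sided derivatives exist along orbits in it.\<close>

lemma max_less_b: "f c < b"
proof (rule ccontr)
  assume "\<not> f c < b"
  then have "f c = b" using maps[of c] turning_point by auto
  then show False using critical_orbit_order(3) f_endpoints by simp
qed

lemma maps_open: "x \<in> {a<..<b} \<Longrightarrow> f x \<in> {a<..<b}"
proof -
  assume x: "x \<in> {a<..<b}"
  have "f x \<le> f c" using f_less_max[of x] x by (cases "x = c") auto
  moreover have "a < f x"
    using f_less_left[of a x] f_less_right[of x b] f_endpoints x by (cases "x \<le> c") auto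
  ultimately show ?thesis using max_less_b by auto
qed

lemma iterate_maps_open: "x \<in> {a<..<b} \<Longrightarrow> (f ^^ n) x \<in> {a<..<b}"
  using maps_open by (induction n) auto

lemma iterate_maps: "x \<in> {a..b} \<Longrightarrow> (f ^^ n) x \<in> {a..b}"
  using maps by (induction n) auto

lemma c1_open: "f c \<in> {a<..<b}"
  using turning_point maps_open[of c] by auto

definition df :: "real \<Rightarrow> real" where "df = deriv_on {a..b} f"

lemma differentiable: "f differentiable_on {a..b}"
  and df_continuous: "continuous_on {a..b} df"
  using S_unimodal unfolding S_unimodal_def Ck_on_def df_def by auto

lemma f_has_derivative: "x \<in> {a<..<b} \<Longrightarrow> (f has_real_derivative df x) (at x)"
  unfolding df_def by (rule differentiable_on_has_deriv_on[OF differentiable]) (simp add: interior_atLeastAtMost_real)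

lemma df_eq_0_iff: "x \<in> {a..b} \<Longrightarrow> df x = 0 \<longleftrightarrow> x = c"
  using S_unimodal unfolding S_unimodal_def df_def by auto

lemma df_pos: "x \<in> {a<..<c} \<Longrightarrow> df x > 0"
proof -
  assume x: "x \<in> {a<..<c}"
  have "mono_on {a..c} f"
    using f_less_left by (intro mono_onI) (metis atLeastAtMost_iff less_le order_refl)
  then have "df x \<ge> 0"
    using x turning_point f_has_derivative[of x]
    by (intro mono_on_imp_deriv_nonneg[of "{a..c}" f]) (auto simp: interior_atLeastAtMost_real)
  then show ?thesis using df_eq_0_iff[of x] x turning_point by force
qed

lemma df_neg: "x \<in> {c<..<b} \<Longrightarrow> df x < 0"
proof -
  assume x: "x \<in> {c<..<b}"
  have "mono_on {c..b} (\<lambda>x. - f x)"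
    using f_less_right by (intro mono_onI) (metis atLeastAtMost_iff less_le order_refl neg_le_iff_le)
  then have "- df x \<ge> 0"
    using x turning_point f_has_derivative[of x]
    by (intro mono_on_imp_deriv_nonneg[of "{c..b}" "\<lambda>x. - f x"] DERIV_minus)
       (auto simp: interior_atLeastAtMost_real)
  then show ?thesis using df_eq_0_iff[of x] x turning_point by force
qed

section \<open>Derivatives of iterates and the two-point inequality\<close>

definition df_iter :: "nat \<Rightarrow> real \<Rightarrow> real" where
  "df_iter n x = (\<Prod>i<n. df ((f ^^ i) x))"

lemma df_iter_0: "df_iter 0 x = 1"
  and df_iter_Suc: "df_iter (Suc n) x = df ((f ^^ n) x) * df_iter n x"
  unfolding df_iter_def by (simp_all add: mult.commute)

lemma iterate_has_derivative:
  "x \<in> {a<..<b} \<Longrightarrow> ((f ^^ n) has_real_derivative df_iter n x) (at x)"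
proof (induction n)
  case 0
  then show ?case by (simp add: df_iter_0 id_def)
next
  case (Suc n)
  have "(f has_real_derivative df ((f ^^ n) x)) (at ((f ^^ n) x))"
    by (rule f_has_derivative[OF iterate_maps_open[OF Suc.prems]])
  from DERIV_chain[OF this Suc.IH[OF Suc.prems]] show ?case
    by (simp add: df_iter_Suc o_def)
qed

lemma deriv_on_iterate: "x \<in> {a<..<b} \<Longrightarrow> deriv_on {a..b} (f ^^ n) x = df_iter n x"
  unfolding deriv_on_def
  using iterate_has_derivative[of x n] turning_point
  by (intro vector_derivative_at_within_ivl) (auto simp: has_real_derivative_iff_has_vector_derivative)

text \<open>Off \<open>c\<close> the inequality for negative Schwarzian derivative applies, on the
  decreasing side to \<open>- f\<close>. If one point is \<open>c\<close>, the left-hand side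
  vanishes, so closed sides are allowed.\<close>

lemma two_point:
  assumes x: "x \<in> {a<..<b}" and y: "y \<in> {a<..<b}"
    and side: "x \<le> c \<and> y \<le> c \<or> c \<le> x \<and> c \<le> y"
  shows "(y - x)\<^sup>2 * \<bar>df x * df y\<bar> \<le> (f y - f x)\<^sup>2"
proof -
  define S where "S = {a..b} - {c}"
  define f1 where "f1 = deriv_on S f"
  define f2 where "f2 = deriv_on S f1"
  define f3 where "f3 = deriv_on S f2"
  have Ck: "Ck_on 3 S f" and neg: "\<And>s. s \<in> S \<Longrightarrow> f1 s \<noteq> 0 \<Longrightarrow> schwarzian_on S f s < 0"
    using S_unimodal unfolding S_unimodal_def S_def f1_def by auto
  have diff: "f differentiable_on S" "f1 differentiable_on S" "f2 differentiable_on S"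
    using Ck unfolding Ck_on_def f1_def f2_def by (auto simp: numeral_3_eq_3 less_Suc_eq)
  have int: "{a<..<b} - {c} \<subseteq> interior S"
    by (rule interior_maximal) (auto simp: S_def intro!: open_Diff)
  have d: "(f has_real_derivative f1 s) (at s)" "(f1 has_real_derivative f2 s) (at s)"
    "(f2 has_real_derivative f3 s) (at s)" if "s \<in> {a<..<b} - {c}" for s
    unfolding f1_def f2_def f3_def using diff that int unfolding f1_def f2_def
    by (auto intro!: differentiable_on_has_deriv_on)
  \<comment> \<open>The Schwarzian condition uses derivatives relative to the punctured interval; at
    interior points the first of them agrees with \<open>df\<close> by uniqueness.\<close>
  have f1: "f1 s = df s" if "s \<in> {a<..<b} - {c}" for s
    using d(1)[OF that] f_has_derivative[of s] that DERIV_unique by blast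
  have neg': "f3 s / f1 s - 3 / 2 * (f2 s / f1 s)\<^sup>2 < 0" if "s \<in> {a<..<b} - {c}" for s
  proof -
    have "s \<in> S" "f1 s \<noteq> 0" using that f1[OF that] df_eq_0_iff[of s] unfolding S_def by auto
    from neg[OF this] show ?thesis
      unfolding schwarzian_on_def f1_def f2_def f3_def by (simp add: numeral_2_eq_2 numeral_3_eq_3)
  qed
  have main: "(v - u)\<^sup>2 * \<bar>df u * df v\<bar> \<le> (f v - f u)\<^sup>2"
    if uv: "u < v" "a < u" "v < b" "v < c \<or> c < u" for u v
  proof (cases "v < c")
    case True
    have sub: "s \<in> {a<..<b} - {c}" if "s \<in> {u..v}" for s using that uv True by auto
    have "(v - u)\<^sup>2 * (f1 u * f1 v) \<le> (f v - f u)\<^sup>2"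
    proof (rule negative_schwarzian_two_point[OF uv(1), of f f1 f2 f3])
      fix s assume s: "s \<in> {u..v}"
      show "f1 s > 0" using f1[OF sub[OF s]] df_pos[of s] s uv True by auto
    qed (use d neg' sub in auto)
    then show ?thesis using f1[of u] f1[of v] df_pos[of u] df_pos[of v] uv True by (simp add: abs_mult)
  next
    case False
    then have cu: "c < u" using uv by blast
    have sub: "s \<in> {a<..<b} - {c}" if "s \<in> {u..v}" for s using that uv cu by auto
    have "(v - u)\<^sup>2 * ((- f1 u) * (- f1 v)) \<le> ((- f v) - (- f u))\<^sup>2"
    proof (rule negative_schwarzian_two_point[OF uv(1), of "\<lambda>x. - f x" "\<lambda>x. - f1 x" "\<lambda>x. - f2 x" "\<lambda>x. - f3 x"])
      fix s assume s: "s \<in> {u..v}"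
      show "- f1 s > 0" using f1[OF sub[OF s]] df_neg[of s] s uv cu by auto
      show "- f3 s / - f1 s - 3 / 2 * (- f2 s / - f1 s)\<^sup>2 < 0" using neg'[OF sub[OF s]] by simp
    qed (use d sub in \<open>auto intro!: DERIV_minus\<close>)
    then show ?thesis using f1[of u] f1[of v] df_neg[of u] df_neg[of v] uv cu
      by (simp add: abs_mult power2_commute)
  qed
  show ?thesis
  proof (cases "x = c \<or> y = c \<or> x = y")
    case True
    then show ?thesis using df_eq_0_iff[of c] turning_point by auto
  next
    case False
    then consider "x < y" "y < c \<or> c < x" | "y < x" "x < c \<or> c < y" using side by force
    then show ?thesis
    proof cases
      case 1 then show ?thesis using main[of x y] x y by auto
    next
      case 2 then show ?thesis using main[of y x] x y by (auto simp: power2_commute mult.commute)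
    qed
  qed
qed

section \<open>Orbit pieces that stay on one side of the turning point\<close>

text \<open>Non-strict, with \<open>c\<close> on both sides, so that a branch may include an
  endpoint whose orbit hits \<open>c\<close>.\<close>

definition same_side :: "nat \<Rightarrow> real \<Rightarrow> real \<Rightarrow> bool" where
  "same_side n x y \<longleftrightarrow> (\<forall>i<n. (f ^^ i) x \<le> c \<and> (f ^^ i) y \<le> c \<or> c \<le> (f ^^ i) x \<and> c \<le> (f ^^ i) y)"

lemma same_side_Suc: "same_side (Suc n) x y \<longleftrightarrow> same_side n x y \<and>
   ((f ^^ n) x \<le> c \<and> (f ^^ n) y \<le> c \<or> c \<le> (f ^^ n) x \<and> c \<le> (f ^^ n) y)"
  unfolding same_side_def by (auto simp: less_Suc_eq)

text \<open>Each step contributes one factor of the chain rule at both points, and one use of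
  \<open>two_point\<close> replaces the squared distance of the images by the next one.\<close>

lemma two_point_iterate:
  assumes x: "x \<in> {a<..<b}" and y: "y \<in> {a<..<b}" and side: "same_side n x y"
  shows "(y - x)\<^sup>2 * \<bar>df_iter n x * df_iter n y\<bar> \<le> ((f ^^ n) y - (f ^^ n) x)\<^sup>2"
  using side
proof (induction n)
  case (Suc n)
  let ?x = "(f ^^ n) x" and ?y = "(f ^^ n) y"
  have "(y - x)\<^sup>2 * \<bar>df_iter (Suc n) x * df_iter (Suc n) y\<bar>
     = ((y - x)\<^sup>2 * \<bar>df_iter n x * df_iter n y\<bar>) * \<bar>df ?x * df ?y\<bar>"
    by (simp add: df_iter_Suc abs_mult)
  also have "\<dots> \<le> (?y - ?x)\<^sup>2 * \<bar>df ?x * df ?y\<bar>"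
    using Suc by (intro mult_right_mono) (auto simp: same_side_Suc)
  also have "\<dots> \<le> (f ?y - f ?x)\<^sup>2"
    using Suc.prems by (intro two_point iterate_maps_open x y) (auto simp: same_side_Suc)
  finally show ?case by simp
qed (simp add: df_iter_0)

lemma iterate_neq:
  assumes "x \<in> {a..b}" "y \<in> {a..b}" "same_side n x y" "x \<noteq> y"
  shows "(f ^^ n) x \<noteq> (f ^^ n) y"
  using assms(3)
proof (induction n)
  case (Suc n)
  then have "(f ^^ n) x \<noteq> (f ^^ n) y" by (simp add: same_side_Suc)
  moreover have "(f ^^ n) x \<in> {a..b}" "(f ^^ n) y \<in> {a..b}" using assms iterate_maps by auto
  ultimately show ?case using Suc.prems f_less_left[of "(f ^^ n) x" "(f ^^ n) y"] f_less_left[of "(f ^^ n) y" "(f ^^ n) x"]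
     f_less_right[of "(f ^^ n) x" "(f ^^ n) y"] f_less_right[of "(f ^^ n) y" "(f ^^ n) x"]
    by (force simp: same_side_Suc not_less_iff_gr_or_eq)
qed (use assms in simp)

lemma f_image_segment:
  assumes "x \<in> {a..b}" "y \<in> {a..b}" "x \<le> c \<and> y \<le> c \<or> c \<le> x \<and> c \<le> y"
  shows "f ` closed_segment x y = closed_segment (f x) (f y)"
proof
  have le_left: "f u \<le> f v" if "a \<le> u" "u \<le> v" "v \<le> c" for u v
    using f_less_left[of u v] that by (cases "u = v") auto
  have le_right: "f v \<le> f u" if "c \<le> u" "u \<le> v" "v \<le> b" for u v
    using f_less_right[of u v] that by (cases "u = v") auto
  show "f ` closed_segment x y \<subseteq> closed_segment (f x) (f y)"
  proof
    fix w assume "w \<in> f ` closed_segment x y"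
    then obtain z where w: "w = f z" and z: "z \<in> closed_segment x y" by blast
    consider "x \<le> z \<and> z \<le> y" | "y \<le> z \<and> z \<le> x"
      using z by (auto simp: closed_segment_eq_real_ivl split: if_splits)
    then have "f x \<le> f z \<and> f z \<le> f y \<or> f y \<le> f z \<and> f z \<le> f x"
      using assms le_left[of x z] le_left[of z y] le_right[of x z] le_right[of z y]
        le_left[of y z] le_left[of z x] le_right[of y z] le_right[of z x]
      by cases auto
    then show "w \<in> closed_segment (f x) (f y)"
      unfolding w by (auto simp: closed_segment_eq_real_ivl)
  qed
  have "closed_segment x y \<subseteq> {a..b}" using assms by (auto simp: closed_segment_eq_real_ivl)
  then have "connected (f ` closed_segment x y)"
    by (intro connected_continuous_image continuous_on_subset[OF continuous]) auto
  then show "closed_segment (f x) (f y) \<subseteq> f ` closed_segment x y"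
    by (intro closed_segment_subset) (auto simp: is_interval_connected_1[symmetric] is_interval_convex_1)
qed

lemma iterate_image_segment:
  assumes "x \<in> {a..b}" "y \<in> {a..b}" "same_side n x y"
  shows "(f ^^ n) ` closed_segment x y = closed_segment ((f ^^ n) x) ((f ^^ n) y)"
  using assms(3)
proof (induction n)
  case (Suc n)
  have "(f ^^ Suc n) ` closed_segment x y = f ` (f ^^ n) ` closed_segment x y" by (simp add: image_comp)
  also have "\<dots> = f ` closed_segment ((f ^^ n) x) ((f ^^ n) y)" using Suc by (simp add: same_side_Suc)
  also have "\<dots> = closed_segment ((f ^^ Suc n) x) ((f ^^ Suc n) y)"
    using Suc.prems f_image_segment[OF iterate_maps[OF assms(1)] iterate_maps[OF assms(2)], of n n]
    by (simp add: same_side_Suc)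
  finally show ?case .
qed simp

lemma same_side_between:
  assumes "x \<in> {a..b}" "y \<in> {a..b}" "same_side n x y" "z \<in> closed_segment x y"
  shows "same_side n z y"
  unfolding same_side_def
proof (intro allI impI)
  fix i assume i: "i < n"
  have "same_side i x y" using assms(3) i unfolding same_side_def by auto
  then have "(f ^^ i) z \<in> closed_segment ((f ^^ i) x) ((f ^^ i) y)"
    using iterate_image_segment[OF assms(1,2)] assms(4) by blast
  then show "(f ^^ i) z \<le> c \<and> (f ^^ i) y \<le> c \<or> c \<le> (f ^^ i) z \<and> c \<le> (f ^^ i) y"
    using assms(3) i unfolding same_side_def by (fastforce simp: closed_segment_eq_real_ivl split: if_splits)
qed

text \<open>This is \<open>one_sided_koebe\<close> on a branch of \<open>f ^^ n\<close> ending at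
  \<open>w\<close>, with \<open>two_point_iterate\<close> as the two-point bound.
  Orientation-reversing branches are treated by a change of sign.\<close>

lemma koebe_iterate:
  assumes ord: "a < x" "x \<le> y" "y < w" "w < b" and side: "same_side n x w"
  shows "(w - y) * \<bar>df_iter n w\<bar> * \<bar>(f ^^ n) y - (f ^^ n) x\<bar>
    \<le> \<bar>(f ^^ n) w - (f ^^ n) x\<bar> * \<bar>(f ^^ n) w - (f ^^ n) y\<bar>"
proof (cases "df_iter n w = 0")
  case False
  let ?g = "f ^^ n"
  have ab: "x \<in> {a..b}" "w \<in> {a..b}" using ord by auto
  have mem: "s \<in> closed_segment x w" if "s \<in> {x..y}" for s
    using that ord by (auto simp: closed_segment_eq_real_ivl)
  have ne: "?g s \<noteq> ?g w" and seg: "?g s \<in> closed_segment (?g x) (?g w)"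
    and tp: "(w - s)\<^sup>2 * (\<bar>df_iter n s\<bar> * \<bar>df_iter n w\<bar>) \<le> (?g w - ?g s)\<^sup>2"
    and dv: "(?g has_real_derivative df_iter n s) (at s)"
    if s: "s \<in> {x..y}" for s
  proof -
    have ss: "same_side n s w" by (rule same_side_between[OF ab side mem[OF s]])
    show "?g s \<noteq> ?g w" using iterate_neq[OF _ _ ss] s ord by auto
    show "?g s \<in> closed_segment (?g x) (?g w)"
      using iterate_image_segment[OF ab side] mem[OF s] by blast
    show "(w - s)\<^sup>2 * (\<bar>df_iter n s\<bar> * \<bar>df_iter n w\<bar>) \<le> (?g w - ?g s)\<^sup>2"
      using two_point_iterate[OF _ _ ss] s ord by (auto simp: abs_mult)
    show "(?g has_real_derivative df_iter n s) (at s)"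
      using iterate_has_derivative[of s n] s ord by auto
  qed
  have m: "\<bar>df_iter n w\<bar> > 0" using False by simp
  consider "?g x < ?g w" | "?g x > ?g w" using ne[of x] ord by force
  then show ?thesis
  proof cases
    case 1
    have less: "?g s < ?g w" if "s \<in> {x..y}" for s
      using ne[OF that] seg[OF that] 1 by (auto simp: closed_segment_eq_real_ivl)
    have le: "(w - y) * \<bar>df_iter n w\<bar> * (?g y - ?g x) \<le> (?g w - ?g x) * (?g w - ?g y)"
      by (rule one_sided_koebe[OF ord(2,3) m dv less tp])
    have "?g x \<le> ?g y" using seg[of y] ord 1 by (auto simp: closed_segment_eq_real_ivl)
    then show ?thesis using le less[of x] less[of y] ord by simp
  next
    case 2
    have less: "- ?g s < - ?g w" if "s \<in> {x..y}" for s
      using ne[OF that] seg[OF that] 2 by (auto simp: closed_segment_eq_real_ivl)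
    have le: "(w - y) * \<bar>df_iter n w\<bar> * ((- ?g y) - (- ?g x)) \<le> ((- ?g w) - (- ?g x)) * ((- ?g w) - (- ?g y))"
    proof (rule one_sided_koebe[OF ord(2,3) m, where g = "\<lambda>s. - ?g s" and g' = "\<lambda>s. - df_iter n s"])
      fix s assume s: "s \<in> {x..y}"
      show "((\<lambda>s. - ?g s) has_real_derivative - df_iter n s) (at s)" by (rule DERIV_minus[OF dv[OF s]])
      show "- ?g s < - ?g w" by (rule less[OF s])
      show "(w - s)\<^sup>2 * (\<bar>- df_iter n s\<bar> * \<bar>df_iter n w\<bar>) \<le> (- ?g w - - ?g s)\<^sup>2"
        using tp[OF s] by (simp add: power2_commute)
    qed
    have "?g y \<le> ?g x" using seg[of y] ord 2 by (auto simp: closed_segment_eq_real_ivl)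
    then show ?thesis using le less[of x] less[of y] ord by simp
  qed
qed simp

end

section \<open>Close returns of the critical orbit\<close>

context S_unimodal_map begin

text \<open>Compares the orbit of \<open>y\<close> with that of \<open>f c\<close>, hence the
  shifted second index. Strictness is what confines \<open>y\<close> to the monotone branch at
  \<open>f c\<close>.\<close>

definition same_strict_side :: "nat \<Rightarrow> real \<Rightarrow> bool" where
  "same_strict_side n y \<longleftrightarrow>
     (\<forall>i<n. (f ^^ i) y < c \<and> (f ^^ Suc i) c < c \<or> c < (f ^^ i) y \<and> c < (f ^^ Suc i) c)"

text \<open>
  The endpoint of \<^term>\<open>D c f (Suc m)\<close> other than \<open>c\<^bsub>m+1\<^esub>\<close>.
\<close>

primrec left_end :: "nat \<Rightarrow> real" where
  "left_end 0 = c"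
| "left_end (Suc m) = (if c \<in> D c f (Suc m) then f c else f (left_end m))"

text \<open>Identifies \<open>D\<close> with the image of a branch: \<open>x\<close> is the left end
  of a piece of \<open>{c..f c}\<close> adjacent to \<open>f c\<close> on which
  \<open>f ^^ m\<close> is monotone. The piece is cut only at cutting times, at a preimage of
  \<open>c\<close>, and a point that strictly shadows \<open>f c\<close> is never cut off.\<close>

lemma D_monotone_branch:
  "\<exists>x\<in>{c..f c}. same_side m x (f c) \<and> (f ^^ m) x = left_end m
     \<and> D c f (Suc m) = closed_segment (left_end m) ((f ^^ Suc m) c)
     \<and> (\<forall>y\<in>{c..f c}. same_strict_side m y \<longrightarrow> x \<le> y)"
proof (induction m)
  case 0
  show ?case using critical_orbit_order(2) by (intro bexI[of _ c]) (auto simp: same_side_def)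
next
  case (Suc m)
  then obtain x where x: "x \<in> {c..f c}" and side: "same_side m x (f c)" and fx: "(f ^^ m) x = left_end m"
    and D: "D c f (Suc m) = closed_segment (left_end m) ((f ^^ Suc m) c)"
    and least: "\<And>y. y \<in> {c..f c} \<Longrightarrow> same_strict_side m y \<Longrightarrow> x \<le> y" by blast
  have ab: "y \<in> {a..b}" if "y \<in> {c..f c}" for y using that turning_point max_less_b by auto
  have c1: "f c \<in> {c..f c}" using critical_orbit_order(2) by simp
  have c1_iter: "(f ^^ m) (f c) = (f ^^ Suc m) c" by (simp add: funpow_swap1)
  show ?case
  proof (cases "c \<in> D c f (Suc m)")
    case True
    have "c \<in> (f ^^ m) ` closed_segment x (f c)"
      using True unfolding D iterate_image_segment[OF ab[OF x] ab[OF c1] side] fx c1_iter .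
    \<comment> \<open>The new left end is the preimage of \<open>c\<close> in the old branch. One
      step later it is sent to \<open>f c\<close>, which explains the reset in
      \<open>left_end\<close>.\<close>
    then obtain z where z: "z \<in> closed_segment x (f c)" "(f ^^ m) z = c" by auto
    have zc: "z \<in> {c..f c}" using z(1) x by (auto simp: closed_segment_eq_real_ivl)
    have zside: "same_side m z (f c)" by (rule same_side_between[OF ab[OF x] ab[OF c1] side z(1)])
    have 1: "same_side (Suc m) z (f c)" using zside z(2) by (auto simp: same_side_Suc)
    have 2: "(f ^^ Suc m) z = left_end (Suc m)" using z(2) True by simp
    have 3: "D c f (Suc (Suc m)) = closed_segment (left_end (Suc m)) ((f ^^ Suc (Suc m)) c)"
      using True by (simp add: closed_segment_commute)
    \<comment> \<open>If \<open>y\<close> were left of \<open>z\<close>, then \<open>c\<close> would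
      lie between the images of \<open>y\<close> and \<open>f c\<close>, which are strictly on one
      side of it.\<close>
    have 4: "z \<le> y" if y: "y \<in> {c..f c}" "same_strict_side (Suc m) y" for y
    proof (rule ccontr)
      assume "\<not> z \<le> y"
      have "x \<le> y" using least[OF y(1)] y(2) unfolding same_strict_side_def by auto
      then have "y \<in> closed_segment x (f c)" using y(1) by (auto simp: closed_segment_eq_real_ivl)
      then have yside: "same_side m y (f c)" by (rule same_side_between[OF ab[OF x] ab[OF c1] side])
      have "z \<in> closed_segment y (f c)"
        using \<open>\<not> z \<le> y\<close> zc by (auto simp: closed_segment_eq_real_ivl)
      then have "(f ^^ m) z \<in> closed_segment ((f ^^ m) y) ((f ^^ m) (f c))"
        using iterate_image_segment[OF ab[OF y(1)] ab[OF c1] yside] by blast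
      then show False using y(2) unfolding z(2) c1_iter same_strict_side_def
        by (auto simp: closed_segment_eq_real_ivl split: if_splits)
    qed
    show ?thesis using zc 1 2 3 4 by blast
  next
    case False
    have out: "left_end m < c \<and> (f ^^ Suc m) c < c \<or> c < left_end m \<and> c < (f ^^ Suc m) c"
      using False unfolding D closed_segment_eq_real_ivl by (auto split: if_splits)
    have 1: "same_side (Suc m) x (f c)"
      unfolding same_side_Suc fx c1_iter using side out by linarith
    have 2: "(f ^^ Suc m) x = left_end (Suc m)" using fx False by simp
    have fxab: "left_end m \<in> {a..b}" using iterate_maps[OF ab[OF x], of m] fx by simp
    have cab: "(f ^^ Suc m) c \<in> {a..b}" using iterate_maps[of c "Suc m"] turning_point by auto
    have "D c f (Suc (Suc m)) = f ` closed_segment (left_end m) ((f ^^ Suc m) c)"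
      using False D by simp
    also have "\<dots> = closed_segment (f (left_end m)) (f ((f ^^ Suc m) c))"
      using out by (intro f_image_segment fxab cab) linarith
    finally have 3: "D c f (Suc (Suc m)) = closed_segment (left_end (Suc m)) ((f ^^ Suc (Suc m)) c)"
      using False by simp
    have 4: "x \<le> y" if y: "y \<in> {c..f c}" "same_strict_side (Suc m) y" for y
      using least[OF y(1)] y(2) unfolding same_strict_side_def by auto
    show ?thesis using x 1 2 3 4 by blast
  qed
qed

lemma D_eq_segment: "D c f (Suc m) = closed_segment (left_end m) ((f ^^ Suc m) c)"
  using D_monotone_branch[of m] by blast

text \<open>The guaranteed length of the image branch beyond \<open>c\<close> when
  \<open>left_end\<close> is \<open>f c\<close> or \<open>f (f c)\<close>.\<close>

definition \<kappa> :: real where "\<kappa> = min (f c - c) (c - f (f c))"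

lemma kappa_pos: "\<kappa> > 0"
  unfolding \<kappa>_def using critical_orbit_order by auto

text \<open>Seen from \<open>left_end m\<close>, the image of \<open>y\<close> lies beyond
  \<open>c\<close>, so the image of \<open>[x, y]\<close> has length at least
  \<open>\<kappa>\<close>; Koebe then makes \<open>f c - y\<close> small against the derivative. Of
  the \<open>Suc m\<close> steps, the first \<open>m\<close> keep \<open>y\<close> on the branch and
  the last locates its image.\<close>

lemma shadowing_distance:
  assumes cut: "c \<in> D c f (Suc m)" and far: "left_end m \<in> {f c, f (f c)}"
    and y: "y \<in> {c<..<f c}" and side: "same_strict_side (Suc m) y"
  shows "(f c - y) * \<bar>df_iter m (f c)\<bar> * \<kappa> \<le> (b - a)\<^sup>2"
proof -
  obtain x where x: "x \<in> {c..f c}" and xside: "same_side m x (f c)" and fx: "(f ^^ m) x = left_end m"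
    and least: "\<And>y. y \<in> {c..f c} \<Longrightarrow> same_strict_side m y \<Longrightarrow> x \<le> y"
    using D_monotone_branch[of m] by blast
  have c1_iter: "(f ^^ m) (f c) = (f ^^ Suc m) c" by (simp add: funpow_swap1)
  let ?y = "(f ^^ m) y"
  have "x \<le> y" using least[of y] y side unfolding same_strict_side_def by auto
  have koebe: "(f c - y) * \<bar>df_iter m (f c)\<bar> * \<bar>?y - left_end m\<bar>
      \<le> \<bar>(f ^^ Suc m) c - left_end m\<bar> * \<bar>(f ^^ Suc m) c - ?y\<bar>"
    using koebe_iterate[of x y "f c" m] x y xside \<open>x \<le> y\<close> turning_point max_less_b
    unfolding fx c1_iter by auto
  have "?y < c \<and> (f ^^ Suc m) c < c \<or> c < ?y \<and> c < (f ^^ Suc m) c"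
    using side unfolding same_strict_side_def by blast
  moreover have "c \<in> closed_segment (left_end m) ((f ^^ Suc m) c)" using cut D_eq_segment by simp
  ultimately have "\<bar>c - left_end m\<bar> \<le> \<bar>?y - left_end m\<bar>"
    by (auto simp: closed_segment_eq_real_ivl split: if_splits)
  moreover have "\<kappa> \<le> \<bar>c - left_end m\<bar>" using far unfolding \<kappa>_def by auto
  ultimately have "\<kappa> \<le> \<bar>?y - left_end m\<bar>" by linarith
  then have "(f c - y) * \<bar>df_iter m (f c)\<bar> * \<kappa> \<le> (f c - y) * \<bar>df_iter m (f c)\<bar> * \<bar>?y - left_end m\<bar>"
    using y by (intro mult_left_mono) auto
  also note koebe
  also have "\<bar>(f ^^ Suc m) c - left_end m\<bar> * \<bar>(f ^^ Suc m) c - ?y\<bar> \<le> (b - a) * (b - a)"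
  proof (rule mult_mono)
    have "(f ^^ Suc m) c \<in> {a..b}" "left_end m \<in> {a..b}" "?y \<in> {a..b}"
      using iterate_maps[of c "Suc m"] iterate_maps[of x m] iterate_maps[of y m] fx x y
        turning_point max_less_b by auto
    then show "\<bar>(f ^^ Suc m) c - left_end m\<bar> \<le> b - a" "\<bar>(f ^^ Suc m) c - ?y\<bar> \<le> b - a" by auto
  qed (use turning_point in auto)
  finally show ?thesis by (simp add: power2_eq_square)
qed

end

section \<open>Cutting times when the kneading map takes only the values 0 and 1\<close>

text \<open>The assumption \<open>not_periodic\<close> makes the positions of orbit points relative
  to \<open>c\<close> strict.\<close>

locale binary_kneading_map = S_unimodal_map +
  fixes q :: "nat \<Rightarrow> nat"
  assumes kneading: "has_kneading_map c f q"
    and q_1: "q 1 = 0" and q_le_1: "k \<ge> 1 \<Longrightarrow> q k \<le> 1"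
    and not_periodic: "n \<ge> 1 \<Longrightarrow> (f ^^ n) c \<noteq> c"
begin

abbreviation S :: "nat \<Rightarrow> nat" where "S k \<equiv> cutting_time c f k"

lemma infinite_cutting_times: "infinite (cutting_times c f)"
  using kneading unfolding has_kneading_map_def by blast

lemma S_strict_mono: "strict_mono S"
  unfolding cutting_time_def[abs_def] by (rule strict_mono_enumerate[OF infinite_cutting_times])

lemma S_cutting: "S k \<ge> 1" "c \<in> D c f (S k)"
  using enumerate_in_set[OF infinite_cutting_times, of k]
  unfolding cutting_time_def cutting_times_def by auto

lemma cutting_imp_S: "n \<ge> 1 \<Longrightarrow> c \<in> D c f n \<Longrightarrow> \<exists>k. S k = n"
  using enumerate_Ex[OF infinite_cutting_times, of n]
  unfolding cutting_time_def cutting_times_def by auto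

lemma S_0: "S 0 = 1"
proof -
  obtain k where "S k = 1" using cutting_imp_S[of 1] by auto
  then have "S 0 \<le> 1" using S_strict_mono by (metis le0 strict_mono_less_eq)
  then show ?thesis using S_cutting(1)[of 0] by simp
qed

lemma S_1: "S 1 = 2"
proof -
  have "S 1 - S 0 = S (q 1)" using kneading unfolding has_kneading_map_def by force
  then show ?thesis using q_1 S_0 by simp
qed

lemma S_Suc: "S (Suc k) = S k + 1 + q (Suc k)"
proof -
  have "S (Suc k) - S k = S (q (Suc k))" using kneading unfolding has_kneading_map_def by force
  moreover have "q (Suc k) = 0 \<or> q (Suc k) = 1" using q_le_1[of "Suc k"] by auto
  moreover have "S k < S (Suc k)" using S_strict_mono by (simp add: strict_mono_Suc_iff)
  ultimately show ?thesis using S_0 S_1 by auto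
qed

lemma left_end_after_cutting: "left_end (S k) = f c"
  using S_cutting[of k] by (cases "S k") auto

text \<open>A block of length 1: \<open>c\<close> lies between \<open>f c\<close> and the new orbit
  point, so the latter is on the left.\<close>

lemma cutting_block_0:
  assumes "q (Suc k) = 0"
  shows "left_end (S (Suc k) - 1) = f c" and "(f ^^ S (Suc k)) c < c"
proof -
  show le: "left_end (S (Suc k) - 1) = f c" using S_Suc[of k] assms left_end_after_cutting[of k] by simp
  have "c \<in> closed_segment (f c) ((f ^^ S (Suc k)) c)"
    using S_cutting[of "Suc k"] D_eq_segment[of "S (Suc k) - 1"] le by simp
  then have "(f ^^ S (Suc k)) c \<le> c"
    using critical_orbit_order(2) by (auto simp: closed_segment_eq_real_ivl split: if_splits)
  then show "(f ^^ S (Suc k)) c < c"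
    using not_periodic[of "S (Suc k)"] S_cutting(1)[of "Suc k"] by force
qed

text \<open>A block of length 2: the intermediate time is not cutting, so its orbit point is on the
  side of \<open>f c\<close>. Then the far end moves to \<open>f (f c)\<close>, left of
  \<open>c\<close>, and the closing orbit point must be on the right.\<close>

lemma cutting_block_1:
  assumes q: "q (Suc k) = 1"
  shows "left_end (S (Suc k) - 1) = f (f c)"
    and "c < (f ^^ (S (Suc k) - 1)) c" and "c < (f ^^ S (Suc k)) c"
proof -
  have Sk: "S (Suc k) = Suc (Suc (S k))" using S_Suc[of k] q by simp
  have no: "c \<notin> D c f (Suc (S k))"
  proof
    assume "c \<in> D c f (Suc (S k))"
    then obtain j where j: "S j = Suc (S k)" using cutting_imp_S[of "Suc (S k)"] by auto
    then have "S k < S j" "S j < S (Suc k)" using Sk by auto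
    then have "k < j" "j < Suc k" using S_strict_mono strict_mono_less by blast+
    then show False by simp
  qed
  then have "c \<notin> closed_segment (f c) ((f ^^ Suc (S k)) c)"
    using D_eq_segment[of "S k"] left_end_after_cutting[of k] by simp
  then show "c < (f ^^ (S (Suc k) - 1)) c"
    using critical_orbit_order(2) Sk by (auto simp: closed_segment_eq_real_ivl split: if_splits)
  show le: "left_end (S (Suc k) - 1) = f (f c)"
    using no left_end_after_cutting[of k] Sk by simp
  have "c \<in> closed_segment (f (f c)) ((f ^^ S (Suc k)) c)"
    using S_cutting[of "Suc k"] D_eq_segment[of "S (Suc k) - 1"] le by simp
  then have "c \<le> (f ^^ S (Suc k)) c"
    using critical_orbit_order(1) by (auto simp: closed_segment_eq_real_ivl split: if_splits)
  then show "c < (f ^^ S (Suc k)) c"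
    using not_periodic[of "S (Suc k)"] S_cutting(1)[of "Suc k"] by force
qed

lemma left_end_cutting: "k \<ge> 1 \<Longrightarrow> left_end (S k - 1) \<in> {f c, f (f c)}"
  using cutting_block_0(1)[of "k - 1"] cutting_block_1(1)[of "k - 1"] q_le_1[of k]
  by (cases "q k = 0") force+

text \<open>Matching values give equal increments after \<open>k\<close> and after 0; the
  \<open>+ 1\<close> accounts for the initial value \<open>S 0\<close>.\<close>

lemma S_add: "prefix_match q k j \<Longrightarrow> S (k + j) + 1 = S k + S j"
proof (induction j)
  case 0
  then show ?case using S_0 by simp
next
  case (Suc j)
  have "prefix_match q k j" using Suc.prems unfolding prefix_match_def by auto
  moreover have "q (Suc (k + j)) = q (Suc j)" using Suc.prems unfolding prefix_match_def by force
  ultimately show ?case using Suc.IH S_Suc[of "k + j"] S_Suc[of j] by simp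
qed

text \<open>Both itineraries start with one point on the right. Each further block appends to both
  of them one point on the left for value 0, or two on the right for value 1, and
  \<open>S_add\<close> aligns the times.\<close>

lemma prefix_match_imp_same_strict_side:
  assumes "k \<ge> 1" "prefix_match q k j"
  shows "same_strict_side (S j) ((f ^^ S k) c)"
  using assms(2)
proof (induction j)
  case 0
  obtain k' where "k = Suc k'" using assms(1) by (cases k) auto
  then have "c < (f ^^ S k) c" using cutting_block_1(3)[of k'] 0 unfolding prefix_match_def by simp
  then show ?case using critical_orbit_order(2) S_0 by (simp add: same_strict_side_def)
next
  case (Suc j)
  have pm: "prefix_match q k j" using Suc.prems unfolding prefix_match_def by auto
  have IH: "same_strict_side (S j) ((f ^^ S k) c)" by (rule Suc.IH[OF pm])
  have qeq: "q (Suc (k + j)) = q (Suc j)" using Suc.prems unfolding prefix_match_def by force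
  have shift: "(f ^^ i) ((f ^^ S k) c) = (f ^^ (i + S k)) c" for i by (simp add: funpow_add)
  have S1: "S j \<ge> 1" by (rule S_cutting)
  have idx: "S (k + j) + 1 = S k + S j" "S (Suc (k + j)) = S (k + j) + 1 + q (Suc j)"
    "S (Suc j) = S j + 1 + q (Suc j)"
    using S_add[OF pm] S_Suc[of "k + j"] S_Suc[of j] qeq by simp_all
  show ?case
  proof (cases "q (Suc j) = 0")
    case True
    have "(f ^^ (S j + S k)) c < c" "(f ^^ Suc (S j)) c < c"
      using cutting_block_0(2)[of "k + j"] cutting_block_0(2)[of j] True qeq idx
      by (simp_all add: add.commute)
    then show ?thesis using IH True idx(3) unfolding same_strict_side_def shift
      by (auto simp: less_Suc_eq)
  next
    case False
    then have q1: "q (Suc j) = 1" using q_le_1[of "Suc j"] by simp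
    have "c < (f ^^ (S j + S k)) c" "c < (f ^^ Suc (S j)) c"
      "c < (f ^^ (Suc (S j) + S k)) c" "c < (f ^^ Suc (Suc (S j))) c"
      using cutting_block_1(2,3)[of "k + j"] cutting_block_1(2,3)[of j] q1 qeq idx
      by (simp_all add: add.commute)
    then show ?thesis using IH q1 idx(3) unfolding same_strict_side_def shift
      by (auto simp: less_Suc_eq)
  qed
qed

text \<open>Here \<open>j \<ge> 1\<close> matters: at \<open>S 0\<close> the left end is
  \<open>c\<close> itself and the branch has no room beyond the turning point.\<close>

lemma close_return:
  assumes "k \<ge> 1" "j \<ge> 1" "prefix_match q k j"
  shows "(f c - (f ^^ S k) c) * \<bar>df_iter (S j - 1) (f c)\<bar> * \<kappa> \<le> (b - a)\<^sup>2"
proof (rule shadowing_distance)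
  have Sj: "Suc (S j - 1) = S j" using S_cutting(1)[of j] by simp
  show "c \<in> D c f (Suc (S j - 1))" unfolding Sj by (rule S_cutting)
  show "left_end (S j - 1) \<in> {f c, f (f c)}" by (rule left_end_cutting[OF assms(2)])
  show side: "same_strict_side (Suc (S j - 1)) ((f ^^ S k) c)"
    unfolding Sj by (rule prefix_match_imp_same_strict_side[OF assms(1,3)])
  have "c < (f ^^ S k) c"
    using side critical_orbit_order(2) unfolding same_strict_side_def by force
  moreover have "(f ^^ S k) c < f c"
  proof -
    have gt: "S k > 1" using S_0 S_strict_mono assms(1) by (metis less_le_trans strict_mono_less zero_less_one)
    then obtain n where n: "S k = Suc n" "n \<ge> 1" by (cases "S k") auto
    have "(f ^^ n) c \<in> {a..b}" using iterate_maps[of c n] turning_point by auto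
    then show ?thesis using f_less_max not_periodic[OF n(2)] n(1) by simp
  qed
  ultimately show "(f ^^ S k) c \<in> {c<..<f c}" by simp
qed

end

section \<open>Failure of the Collet--Eckmann condition\<close>

lemma Ck_on_UNIV_has_derivative:
  assumes "Ck_on k UNIV g" "k \<ge> 1"
  shows "(g has_real_derivative deriv_on UNIV g x) (at x)"
  using assms unfolding Ck_on_def
  by (intro differentiable_on_has_deriv_on) force+

lemma Ck_on_UNIV_continuous_derivative:
  assumes "Ck_on k UNIV g" "k \<ge> 2"
  shows "continuous_on S (deriv_on UNIV g)"
proof -
  have "1 < k" using assms(2) by simp
  then have "(deriv_on UNIV ^^ 1) g differentiable_on UNIV"
    using assms(1) unfolding Ck_on_def by blast
  then have "continuous_on UNIV (deriv_on UNIV g)"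
    using differentiable_imp_continuous_on by simp
  then show ?thesis by (rule continuous_on_subset) simp
qed

lemma Ck_diffeo_derivative_nonzero:
  assumes "Ck_diffeo k g" "k \<ge> 1"
  shows "deriv_on UNIV g x \<noteq> 0"
proof -
  have g: "(g has_real_derivative deriv_on UNIV g x) (at x)"
    and h: "(inv g has_real_derivative deriv_on UNIV (inv g) (g x)) (at (g x))"
    using assms Ck_on_UNIV_has_derivative unfolding Ck_diffeo_def by blast+
  have "inv g \<circ> g = id" using assms unfolding Ck_diffeo_def by (simp add: bij_is_inj)
  then have "((\<lambda>x. x) has_real_derivative deriv_on UNIV (inv g) (g x) * deriv_on UNIV g x) (at x)"
    using DERIV_chain[OF h g] by (simp add: id_def)
  moreover have "((\<lambda>x. x) has_real_derivative 1) (at x)" by (rule DERIV_ident)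
  ultimately have "deriv_on UNIV (inv g) (g x) * deriv_on UNIV g x = 1" by (rule DERIV_unique)
  then show ?thesis by auto
qed

lemma continuous_on_interval_bounded:
  fixes g :: "real \<Rightarrow> real"
  assumes "continuous_on {a..b} g"
  obtains M where "M > 0" "\<And>x. x \<in> {a..b} \<Longrightarrow> \<bar>g x\<bar> \<le> M"
proof -
  have "bounded (g ` {a..b})"
    using compact_continuous_image[OF assms] compact_imp_bounded by blast
  then obtain M where "M > 0" "\<forall>y\<in>g ` {a..b}. norm y \<le> M"
    unfolding bounded_pos by blast
  then show ?thesis using that[of M] by simp
qed

context S_unimodal_map begin

text \<open>Differentiating the non-flatness equation bounds \<open>df x\<close> by a multiple of
  the power \<open>l - 1\<close> of \<open>\<phi> x\<close>, that is, the power
  \<open>1 - 1 / l\<close> of \<open>\<psi> (f x)\<close>. The bound uses \<open>f c - f x\<close>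
  because close returns are measured at the critical value.\<close>

lemma derivative_near_critical_point:
  obtains B \<delta> where "B > 0" "\<delta> > 0" "{c-\<delta>..c+\<delta>} \<subseteq> {a<..<b}"
    "\<And>x. x \<in> {c-\<delta>..c+\<delta>} \<Longrightarrow> \<bar>df x\<bar> \<le> B * (f c - f x) powr (1 - 1 / l)"
proof -
  have "nonflat l c f" using S_unimodal unfolding S_unimodal_def by blast
  then obtain \<phi> \<psi> where phi: "Ck_diffeo 3 \<phi>" and psi: "Ck_diffeo 3 \<psi>"
    and phi0: "\<phi> c = 0" and psi0: "\<psi> (f c) = 0"
    and ev: "\<forall>\<^sub>F x in nhds c. \<bar>\<psi> (f x)\<bar> = \<bar>\<phi> x\<bar> powr l"
    unfolding nonflat_def by blast
  obtain e where e: "e > 0" and eq: "\<And>x. dist x c < e \<Longrightarrow> \<bar>\<psi> (f x)\<bar> = \<bar>\<phi> x\<bar> powr l"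
    using ev unfolding eventually_nhds_metric by blast
  define \<phi>' \<psi>' where "\<phi>' = deriv_on UNIV \<phi>" and "\<psi>' = deriv_on UNIV \<psi>"
  have dphi: "(\<phi> has_real_derivative \<phi>' x) (at x)" and dpsi: "(\<psi> has_real_derivative \<psi>' x) (at x)" for x
    using phi psi Ck_on_UNIV_has_derivative[of 3] unfolding Ck_diffeo_def \<phi>'_def \<psi>'_def by auto
  have cphi: "continuous_on {a..b} \<phi>'" and cpsi: "continuous_on {a..b} \<psi>'"
    using phi psi Ck_on_UNIV_continuous_derivative[of 3] unfolding Ck_diffeo_def \<phi>'_def \<psi>'_def by auto
  have psi'nz: "\<psi>' x \<noteq> 0" for x
    using Ck_diffeo_derivative_nonzero[OF psi] unfolding \<psi>'_def by simp
  obtain M1 where M1: "M1 > 0" "\<And>x. x \<in> {a..b} \<Longrightarrow> \<bar>\<phi>' x\<bar> \<le> M1"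
    using continuous_on_interval_bounded[OF cphi] by blast
  obtain M2 where M2: "M2 > 0" "\<And>x. x \<in> {a..b} \<Longrightarrow> \<bar>\<psi>' x\<bar> \<le> M2"
    using continuous_on_interval_bounded[OF cpsi] by blast
  have "continuous_on {a..b} (\<lambda>x. 1 / \<psi>' x)"
    using psi'nz by (intro continuous_on_divide cpsi continuous_on_const) auto
  then obtain M3 where M3: "M3 > 0" "\<And>x. x \<in> {a..b} \<Longrightarrow> \<bar>1 / \<psi>' x\<bar> \<le> M3"
    using continuous_on_interval_bounded by blast
  define \<delta> where "\<delta> = min e (min (c - a) (b - c)) / 2"
  have d: "\<delta> > 0" "\<delta> < e" "\<delta> < c - a" "\<delta> < b - c"
    unfolding \<delta>_def using e turning_point by (auto simp: min_def)
  define B where "B = l * M1 * M3 * M2 powr (1 - 1 / l)"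
  have B: "B > 0" unfolding B_def using l_gt_1 M1 M2 M3 by simp
  have "\<bar>df x\<bar> \<le> B * (f c - f x) powr (1 - 1 / l)" if x: "x \<in> {c-\<delta>..c+\<delta>}" for x
  proof (cases "x = c")
    case True
    then show ?thesis using df_eq_0_iff[of c] turning_point by simp
  next
    case False
    have xab: "x \<in> {a<..<b}" and xe: "dist x c < e" using x d by (auto simp: dist_real_def)
    have fxab: "f x \<in> {a<..<b}" by (rule maps_open[OF xab])
    have phix: "\<phi> x \<noteq> 0"
      using False phi0 phi unfolding Ck_diffeo_def by (metis bij_is_inj injD)
    have psi_eq: "\<bar>\<psi> (f x)\<bar> = \<bar>\<phi> x\<bar> powr l" by (rule eq[OF xe])
    \<comment> \<open>Squares remove the absolute values, so both sides of the non-flatness equation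
      can be differentiated where \<open>\<phi> x \<noteq> 0\<close>.\<close>
    have d1: "((\<lambda>x. (\<psi> (f x))\<^sup>2) has_real_derivative 2 * \<psi> (f x) * (\<psi>' (f x) * df x)) (at x)"
      by (rule derivative_eq_intros DERIV_chain2[OF dpsi f_has_derivative[OF xab]] refl | simp)+
    have d2: "((\<lambda>x. ((\<phi> x)\<^sup>2) powr l) has_real_derivative
        l * ((\<phi> x)\<^sup>2) powr (l - 1) * (2 * \<phi> x * \<phi>' x)) (at x)"
      using phix by (auto intro!: derivative_eq_intros dphi)
    have "\<forall>\<^sub>F y in nhds x. (\<psi> (f y))\<^sup>2 = ((\<phi> y)\<^sup>2) powr l"
      unfolding eventually_nhds_metric
    proof (intro exI[of _ "e - dist x c"] conjI allI impI)
      fix y assume "dist y x < e - dist x c"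
      then have "dist y c < e" using dist_triangle[of y c x] by linarith
      then have "(\<psi> (f y))\<^sup>2 = (\<bar>\<phi> y\<bar> powr l)\<^sup>2" using eq by (metis power2_abs)
      also have "\<dots> = (\<bar>\<phi> y\<bar>\<^sup>2) powr l"
        by (simp only: power2_eq_square powr_mult)
      also have "\<dots> = ((\<phi> y)\<^sup>2) powr l" by (simp only: power2_abs)
      finally show "(\<psi> (f y))\<^sup>2 = ((\<phi> y)\<^sup>2) powr l" .
    qed (use xe in simp)
    then have "2 * \<psi> (f x) * (\<psi>' (f x) * df x) = l * ((\<phi> x)\<^sup>2) powr (l - 1) * (2 * \<phi> x * \<phi>' x)"
      using d1 d2 DERIV_cong_ev[of x x "\<lambda>y. (\<psi> (f y))\<^sup>2" "\<lambda>y. ((\<phi> y)\<^sup>2) powr l"] DERIV_unique by blast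
    then have "\<bar>2 * \<psi> (f x) * (\<psi>' (f x) * df x)\<bar> = \<bar>l * ((\<phi> x)\<^sup>2) powr (l - 1) * (2 * \<phi> x * \<phi>' x)\<bar>"
      by simp
    then have "\<bar>\<psi> (f x)\<bar> * (\<bar>\<psi>' (f x)\<bar> * \<bar>df x\<bar>) = l * ((\<phi> x)\<^sup>2) powr (l - 1) * (\<bar>\<phi> x\<bar> * \<bar>\<phi>' x\<bar>)"
      using l_gt_1 by (simp add: abs_mult)
    \<comment> \<open>Splits off the power \<open>l\<close> of \<open>\<phi> x\<close>, which equals
      \<open>\<bar>\<psi> (f x)\<bar>\<close> and cancels.\<close>
    moreover have "((\<phi> x)\<^sup>2) powr (l - 1) * \<bar>\<phi> x\<bar> = \<bar>\<phi> x\<bar> powr l * \<bar>\<phi> x\<bar> powr (l - 1)"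
    proof -
      have "(\<bar>\<phi> x\<bar>\<^sup>2) powr (l - 1) = \<bar>\<phi> x\<bar> powr (l - 1) * \<bar>\<phi> x\<bar> powr (l - 1)"
        by (simp only: power2_eq_square powr_mult)
      then have "((\<phi> x)\<^sup>2) powr (l - 1) = \<bar>\<phi> x\<bar> powr (l - 1) * \<bar>\<phi> x\<bar> powr (l - 1)"
        by (simp only: power2_abs)
      moreover have "\<bar>\<phi> x\<bar> powr l = \<bar>\<phi> x\<bar> powr (l - 1) * \<bar>\<phi> x\<bar>"
        using phix powr_add[of "\<bar>\<phi> x\<bar>" "l - 1" 1] by simp
      ultimately show ?thesis by simp
    qed
    ultimately have "\<bar>\<phi> x\<bar> powr l * (\<bar>\<psi>' (f x)\<bar> * \<bar>df x\<bar>) = \<bar>\<phi> x\<bar> powr l * (l * \<bar>\<phi> x\<bar> powr (l - 1) * \<bar>\<phi>' x\<bar>)"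
      unfolding psi_eq by (simp add: mult_ac)
    then have deq: "\<bar>\<psi>' (f x)\<bar> * \<bar>df x\<bar> = l * \<bar>\<phi> x\<bar> powr (l - 1) * \<bar>\<phi>' x\<bar>"
      using phix by simp
    have "\<bar>\<phi> x\<bar> powr (l - 1) = \<bar>\<psi> (f x)\<bar> powr (1 - 1 / l)"
      unfolding psi_eq powr_powr using l_gt_1 by (simp add: right_diff_distrib)
    also have "\<dots> \<le> (M2 * (f c - f x)) powr (1 - 1 / l)"
    proof (rule powr_mono2)
      have "norm (\<psi> (f c) - \<psi> (f x)) \<le> M2 * norm (f c - f x)"
      proof (rule field_differentiable_bound[where S = "{a..b}" and f' = \<psi>'])
        fix z assume "z \<in> {a..b}"
        then show "(\<psi> has_field_derivative \<psi>' z) (at z within {a..b})" "norm (\<psi>' z) \<le> M2"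
          using M2 dpsi[of z] by (auto intro: has_field_derivative_at_within)
      qed (use fxab c1_open in auto)
      then show "\<bar>\<psi> (f x)\<bar> \<le> M2 * (f c - f x)"
        using psi0 f_less_max[of x] False xab by simp
    qed (use l_gt_1 in auto)
    also have "\<dots> = M2 powr (1 - 1 / l) * (f c - f x) powr (1 - 1 / l)"
      by (rule powr_mult)
    finally have pw: "\<bar>\<phi> x\<bar> powr (l - 1) \<le> M2 powr (1 - 1 / l) * (f c - f x) powr (1 - 1 / l)" .
    have "\<bar>df x\<bar> = \<bar>1 / \<psi>' (f x)\<bar> * (l * \<bar>\<phi> x\<bar> powr (l - 1) * \<bar>\<phi>' x\<bar>)"
      using deq psi'nz[of "f x"] by (simp add: field_simps)
    also have "\<dots> \<le> M3 * (l * (M2 powr (1 - 1 / l) * (f c - f x) powr (1 - 1 / l)) * M1)"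
      using M3 M1 fxab xab l_gt_1 pw by (intro mult_mono) auto
    also have "\<dots> = B * (f c - f x) powr (1 - 1 / l)" unfolding B_def by simp
    finally show ?thesis .
  qed
  moreover have "{c-\<delta>..c+\<delta>} \<subseteq> {a<..<b}"
    unfolding subset_eq atLeastAtMost_iff greaterThanLessThan_iff using d(3,4) by force
  ultimately show ?thesis using that[of B \<delta>] B d(1) by blast
qed

text \<open>Away from \<open>c\<close> monotonicity keeps \<open>f c - f x\<close> above
  \<open>\<eta>\<close> while \<open>df\<close> is bounded, so a larger constant covers the whole
  interval.\<close>

lemma derivative_bound:
  obtains B where "B > 0" "\<And>x. x \<in> {a..b} \<Longrightarrow> \<bar>df x\<bar> \<le> B * (f c - f x) powr (1 - 1 / l)"
proof -
  obtain B \<delta> where B: "B > 0" and d: "\<delta> > 0" "{c-\<delta>..c+\<delta>} \<subseteq> {a<..<b}"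
    and near: "\<And>x. x \<in> {c-\<delta>..c+\<delta>} \<Longrightarrow> \<bar>df x\<bar> \<le> B * (f c - f x) powr (1 - 1 / l)"
    by (rule derivative_near_critical_point) blast
  obtain M where M: "M > 0" "\<And>x. x \<in> {a..b} \<Longrightarrow> \<bar>df x\<bar> \<le> M"
    using continuous_on_interval_bounded[OF df_continuous] by blast
  define \<eta> where "\<eta> = min (f c - f (c - \<delta>)) (f c - f (c + \<delta>))"
  have "c - \<delta> \<in> {c-\<delta>..c+\<delta>}" "c + \<delta> \<in> {c-\<delta>..c+\<delta>}" using d(1) by auto
  then have "c - \<delta> \<in> {a<..<b}" "c + \<delta> \<in> {a<..<b}" using d(2) by blast+
  then have eta: "\<eta> > 0" unfolding \<eta>_def using f_less_max[of "c - \<delta>"] f_less_max[of "c + \<delta>"] d(1) by auto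
  let ?p = "1 - 1 / l"
  have p: "?p \<ge> 0" using l_gt_1 by simp
  define C where "C = M / \<eta> powr ?p"
  have C: "C > 0" unfolding C_def using M eta by simp
  have "\<bar>df x\<bar> \<le> (B + C) * (f c - f x) powr ?p" if x: "x \<in> {a..b}" for x
  proof (cases "x \<in> {c-\<delta>..c+\<delta>}")
    case True
    have "C * (f c - f x) powr ?p \<ge> 0" using C by simp
    then show ?thesis using near[OF True] by (simp add: distrib_right)
  next
    case False
    have "\<eta> \<le> f c - f x"
      unfolding \<eta>_def using False x d f_less_left[of x "c - \<delta>"] f_less_right[of "c + \<delta>" x] by force
    then have "\<eta> powr ?p \<le> (f c - f x) powr ?p" using eta p by (intro powr_mono2) auto
    then have "C * \<eta> powr ?p \<le> C * (f c - f x) powr ?p" using C by (intro mult_left_mono) auto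
    moreover have "C * \<eta> powr ?p = M" unfolding C_def using eta by simp
    moreover have "B * (f c - f x) powr ?p \<ge> 0" using B by simp
    ultimately show ?thesis using M(2)[OF x] by (simp only: distrib_right)
  qed
  then show ?thesis using that[of "B + C"] B C by auto
qed

end

context S_unimodal_map begin

lemma collet_eckmannE:
  assumes "collet_eckmann a b c f"
  obtains C r where "C > 0" "r > 1" "\<And>n. n \<ge> 1 \<Longrightarrow> C * r ^ n \<le> \<bar>df_iter n (f c)\<bar>"
  using assms unfolding collet_eckmann_def deriv_on_iterate[OF c1_open] by blast

text \<open>A return of \<open>c\<close> to itself would put a zero factor into the derivative along
  the orbit of \<open>f c\<close>.\<close>

lemma collet_eckmann_imp_not_periodic:
  assumes "collet_eckmann a b c f" "n \<ge> 1"
  shows "(f ^^ n) c \<noteq> c"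
proof
  assume per: "(f ^^ n) c = c"
  obtain C r where C: "C > 0" "r > 1" and ce: "\<And>n. n \<ge> 1 \<Longrightarrow> C * r ^ n \<le> \<bar>df_iter n (f c)\<bar>"
    by (rule collet_eckmannE[OF assms(1)]) blast
  obtain m where m: "n = Suc m" using assms(2) by (cases n) auto
  have "(f ^^ m) (f c) = c" using per unfolding m by (simp add: funpow_swap1)
  then have "df_iter n (f c) = 0"
    unfolding m df_iter_Suc using df_eq_0_iff[of c] turning_point by simp
  moreover have "C * r ^ n > 0" using C by simp
  ultimately show False using ce[OF assms(2)] by simp
qed

end

section \<open>Exponential losses at cutting times\<close>

context binary_kneading_map begin

lemma S_ge: "S k \<ge> k + 1"
  by (induction k) (simp_all add: S_0 S_Suc)

lemma S_le: "S k \<le> 2 * k + 1"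
proof (induction k)
  case (Suc k)
  then show ?case using S_Suc[of k] q_le_1[of "Suc k"] by simp
qed (simp add: S_0)

text \<open>By \<open>close_return\<close>, derivative growth makes
  \<open>f c - (f ^^ S k) c\<close> exponentially small in \<open>j\<close>;
  \<open>derivative_bound\<close> passes this on with the exponent \<open>p = 1 - 1 / l\<close>,
  positive as \<open>l > 1\<close>. The loss occurs at time \<open>S k - 1\<close>, one step before
  the return.\<close>

lemma derivative_at_close_return:
  assumes C: "C > 0" "r > 1" and ce: "\<And>n. n \<ge> 1 \<Longrightarrow> C * r ^ n \<le> \<bar>df_iter n (f c)\<bar>"
  obtains K s where "K \<ge> 1" "0 < s" "s < 1" "\<And>x. x \<in> {a..b} \<Longrightarrow> \<bar>df x\<bar> \<le> K"
    "\<And>k j. k \<ge> 1 \<Longrightarrow> j \<ge> 1 \<Longrightarrow> prefix_match q k j \<Longrightarrow> \<bar>df ((f ^^ (S k - 1)) c)\<bar> \<le> K * s ^ j"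
proof -
  define p where "p = 1 - 1 / l"
  have p: "p > 0" unfolding p_def using l_gt_1 by simp
  obtain B where B: "B > 0" "\<And>x. x \<in> {a..b} \<Longrightarrow> \<bar>df x\<bar> \<le> B * (f c - f x) powr p"
    unfolding p_def by (rule derivative_bound) blast
  obtain M where M: "M > 0" "\<And>x. x \<in> {a..b} \<Longrightarrow> \<bar>df x\<bar> \<le> M"
    using continuous_on_interval_bounded[OF df_continuous] by blast
  define R where "R = (b - a)\<^sup>2 / (C * \<kappa>)"
  have R: "R > 0" unfolding R_def using C kappa_pos turning_point by simp
  define s where "s = r powr (- p)"
  have s: "0 < s" "s < 1"
    unfolding s_def using C p powr_less_mono[of "- p" 0 r] by auto
  \<comment> \<open>One constant serves as uniform bound for the derivative and as prefactor of the
    close-return estimate.\<close>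
  define K where "K = max (max 1 M) (B * R powr p)"
  have K: "K \<ge> 1" "M \<le> K" "B * R powr p \<le> K" unfolding K_def by auto
  have "\<bar>df ((f ^^ (S k - 1)) c)\<bar> \<le> K * s ^ j"
    if k: "k \<ge> 1" and j: "j \<ge> 1" and pm: "prefix_match q k j" for k j
  proof -
    let ?x = "(f ^^ (S k - 1)) c"
    have x: "?x \<in> {a..b}" using iterate_maps[of c "S k - 1"] turning_point by auto
    have "f ?x = (f ^^ Suc (S k - 1)) c" by simp
    then have fx: "f ?x = (f ^^ S k) c" using S_cutting(1)[of k] by simp
    have nonneg: "0 \<le> f c - f ?x" using f_less_max[OF x] by (cases "?x = c") auto
    have "C * r ^ j \<le> C * r ^ (S j - 1)" using C S_ge[of j] by (intro mult_left_mono power_increasing) auto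
    also have "\<dots> \<le> \<bar>df_iter (S j - 1) (f c)\<bar>" using S_ge[of j] j by (intro ce) auto
    finally have "(f c - f ?x) * (C * r ^ j) * \<kappa> \<le> (f c - f ?x) * \<bar>df_iter (S j - 1) (f c)\<bar> * \<kappa>"
      using nonneg kappa_pos by (intro mult_right_mono mult_left_mono) auto
    also have "\<dots> \<le> (b - a)\<^sup>2" unfolding fx by (rule close_return[OF k j pm])
    finally have "f c - f ?x \<le> R / r ^ j"
      unfolding R_def using C kappa_pos by (simp add: divide_simps mult_ac)
    then have "(f c - f ?x) powr p \<le> (R / r ^ j) powr p" using nonneg p by (intro powr_mono2) auto
    also have "\<dots> = R powr p * s ^ j"
    proof -
      have "s ^ j = r powr (- (real j * p))"
        unfolding s_def using C by (simp add: powr_powr mult.commute flip: powr_realpow)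
      moreover have "(r ^ j) powr p = r powr (real j * p)"
        using C by (simp add: powr_powr flip: powr_realpow)
      ultimately show ?thesis using R C
        by (simp add: powr_divide powr_minus_divide mult.commute)
    qed
    finally have "B * (f c - f ?x) powr p \<le> B * (R powr p * s ^ j)" using B(1) by (intro mult_left_mono) auto
    also have "\<dots> \<le> K * s ^ j" using mult_right_mono[OF K(3), of "s ^ j"] s by (simp add: mult.assoc)
    finally show ?thesis using B(2)[OF x] by linarith
  qed
  moreover have "\<bar>df x\<bar> \<le> K" if "x \<in> {a..b}" for x using M(2)[OF that] K(2) by linarith
  ultimately show ?thesis using that[of K s] K(1) s by blast
qed

text \<open>Over \<open>S N \<le> 2 * N + 1\<close> steps the derivative is at most one
  \<open>K\<close> per step times \<open>s\<close> to the total match length. Superlinearity makes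
  that total at least \<open>A * N\<close> for a prescribed \<open>A\<close>, which beats the
  factors \<open>K\<close>.\<close>

lemma not_collet_eckmann:
  assumes superlinear: "\<And>A. \<exists>J. \<forall>N0. \<exists>N\<ge>N0.
    (\<Sum>k=1..N. real (card {j\<in>{1..J}. prefix_match q k j})) \<ge> A * real N"
  shows "\<not> collet_eckmann a b c f"
proof
  assume "collet_eckmann a b c f"
  then obtain C r where C: "C > 0" "r > 1" and ce: "\<And>n. n \<ge> 1 \<Longrightarrow> C * r ^ n \<le> \<bar>df_iter n (f c)\<bar>"
    by (rule collet_eckmannE) blast
  obtain K s where K: "K \<ge> 1" and s: "0 < s" "s < 1" and bound: "\<And>x. x \<in> {a..b} \<Longrightarrow> \<bar>df x\<bar> \<le> K"
    and close: "\<And>k j. k \<ge> 1 \<Longrightarrow> j \<ge> 1 \<Longrightarrow> prefix_match q k j \<Longrightarrow> \<bar>df ((f ^^ (S k - 1)) c)\<bar> \<le> K * s ^ j"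
    by (rule derivative_at_close_return[OF C ce]) blast+
  have orbit: "(f ^^ n) c \<in> {a..b}" for n using iterate_maps[of c n] turning_point by auto
  \<comment> \<open>Two factors \<open>K\<close> per cutting time are to be outweighed by an average
    match length \<open>A\<close>, leaving a factor below 1/2.\<close>
  obtain A :: nat where A: "s ^ A < 1 / (2 * K\<^sup>2)"
    using real_arch_pow_inv[of "1 / (2 * K\<^sup>2)" s] K s by auto
  obtain J where J: "\<And>N0. \<exists>N\<ge>N0.
    (\<Sum>k=1..N. real (card {j\<in>{1..J}. prefix_match q k j})) \<ge> real A * real N"
    using superlinear[of "real A"] by blast
  define m where "m k = card {j\<in>{1..J}. prefix_match q k j}" for k
  obtain N0 :: nat where N0: "(1/2) ^ N0 < C / K"
    using real_arch_pow_inv[of "C / K" "1/2"] C K by auto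
  obtain N where N: "N \<ge> N0" and "(\<Sum>k=1..N. real (m k)) \<ge> real A * real N"
    using J[of N0] unfolding m_def by blast
  then have "real (A * N) \<le> real (\<Sum>k=1..N. m k)" by simp
  then have sum_m: "A * N \<le> (\<Sum>k=1..N. m k)" by (simp only: of_nat_le_iff)
  have m_bound: "\<bar>df ((f ^^ (S k - 1)) c)\<bar> \<le> K * s ^ m k" if k: "k \<ge> 1" for k
  proof (cases "{j\<in>{1..J}. prefix_match q k j} = {}")
    case True
    then have "m k = 0" unfolding m_def by (simp only: card.empty)
    then show ?thesis using bound[OF orbit] by simp
  next
    case False
    define j where "j = Max {j\<in>{1..J}. prefix_match q k j}"
    have "j \<in> {j\<in>{1..J}. prefix_match q k j}" unfolding j_def by (rule Max_in) (use False in auto)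
    then have j: "j \<ge> 1" "prefix_match q k j" by auto
    have "{j\<in>{1..J}. prefix_match q k j} \<subseteq> {1..j}" unfolding j_def by (auto intro!: Max_ge)
    then have "m k \<le> j" unfolding m_def using card_mono[of "{1..j}"] by fastforce
    then have "s ^ j \<le> s ^ m k" using s by (intro power_decreasing) auto
    then have "K * s ^ j \<le> K * s ^ m k" using K by (intro mult_left_mono) auto
    then show ?thesis using close[OF k j] by linarith
  qed
  \<comment> \<open>Assigns the exponent \<open>m k\<close> to its factor in the product: factor
    \<open>i\<close> sits at time \<open>Suc i\<close>, which is \<open>S k - 1\<close> for
    \<open>i = S k - 2\<close>. The subtraction is not truncated, because \<open>S k \<ge> 2\<close>
    for \<open>k \<ge> 1\<close>.\<close>
  define w where "w i = (\<Sum>k=1..N. if S k - 2 = i then m k else 0)" for i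
  have w_bound: "\<bar>df ((f ^^ Suc i) c)\<bar> \<le> K * s ^ w i" for i
  proof (cases "\<exists>k\<in>{1..N}. S k - 2 = i")
    case True
    then obtain k where k: "k \<in> {1..N}" "S k - 2 = i" by blast
    have "S k' - 2 = i \<longleftrightarrow> k' = k" if "k' \<in> {1..N}" for k'
    proof
      assume "S k' - 2 = i"
      then have "S k' = S k" using k S_ge[of k] S_ge[of k'] that by auto
      then show "k' = k" using S_strict_mono by (simp add: strict_mono_eq)
    qed (use k in simp)
    then have "w i = (\<Sum>k'=1..N. if k' = k then m k' else 0)" unfolding w_def by (intro sum.cong) auto
    also have "\<dots> = m k" using k(1) by simp
    finally have "w i = m k" .
    moreover have "Suc i = S k - 1" using k S_ge[of k] by auto
    ultimately show ?thesis using m_bound[of k] k(1) by simp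
  next
    case False
    then have "w i = 0" unfolding w_def by (intro sum.neutral) auto
    then show ?thesis using bound[OF orbit[of "Suc i"]] by simp
  qed
  have sum_w: "(\<Sum>i<S N. w i) = (\<Sum>k=1..N. m k)"
  proof -
    have "(\<Sum>i<S N. w i) = (\<Sum>k=1..N. \<Sum>i<S N. if S k - 2 = i then m k else 0)"
      unfolding w_def by (rule sum.swap)
    also have "\<dots> = (\<Sum>k=1..N. m k)"
    proof (intro sum.cong refl)
      fix k assume "k \<in> {1..N}"
      then have "S k \<le> S N" "S k \<ge> 2"
        using S_strict_mono S_ge[of k] by (auto simp: strict_mono_less_eq)
      then show "(\<Sum>i<S N. if S k - 2 = i then m k else 0) = m k" by simp
    qed
    finally show ?thesis .
  qed
  have "C * 1 \<le> C * r ^ S N" using C by (intro mult_left_mono one_le_power) auto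
  also have "\<dots> \<le> \<bar>df_iter (S N) (f c)\<bar>" by (rule ce[OF S_cutting(1)])
  also have "\<dots> = (\<Prod>i<S N. \<bar>df ((f ^^ Suc i) c)\<bar>)"
    unfolding df_iter_def abs_prod by (simp add: funpow_swap1)
  also have "\<dots> \<le> (\<Prod>i<S N. K * s ^ w i)" using w_bound by (intro prod_mono) auto
  also have "\<dots> = K ^ S N * s ^ (\<Sum>k=1..N. m k)"
    by (simp add: prod.distrib sum_w flip: power_sum)
  also have "\<dots> \<le> K ^ (2 * N + 1) * s ^ (A * N)"
    using K s S_le[of N] sum_m by (intro mult_mono power_increasing power_decreasing) auto
  also have "\<dots> = K * (K\<^sup>2 * s ^ A) ^ N"
    by (simp add: power_mult_distrib power_mult)
  also have "\<dots> \<le> K * (1 / 2) ^ N"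
  proof -
    have "K\<^sup>2 * s ^ A \<le> 1 / 2" using A K by (simp add: field_simps)
    then show ?thesis using K s by (intro mult_left_mono power_mono) auto
  qed
  also have "\<dots> \<le> K * (1 / 2) ^ N0"
    using K N by (intro mult_left_mono power_decreasing) auto
  also have "\<dots> < C" using N0 K by (simp add: field_simps)
  finally show False by simp
qed

end

lemma \<omega>_of_bounds: "0 < \<gamma> \<Longrightarrow> \<gamma> < 1 / 2 \<Longrightarrow> 0 < \<omega>_of \<gamma> \<and> \<omega>_of \<gamma> < 1"
  unfolding \<omega>_of_def by (simp add: field_simps)

lemma Q_of_1: "0 < \<omega>_of \<gamma> \<Longrightarrow> \<omega>_of \<gamma> < 1 \<Longrightarrow> Q_of \<gamma> 1 = 0"
  unfolding Q_of_def by (simp add: floor_eq_iff)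

lemma Q_of_le_1: "0 < \<omega>_of \<gamma> \<Longrightarrow> \<omega>_of \<gamma> < 1 \<Longrightarrow> Q_of \<gamma> k \<le> 1"
proof -
  assume w: "0 < \<omega>_of \<gamma>" "\<omega>_of \<gamma> < 1"
  have "real k * \<omega>_of \<gamma> \<le> (real k - 1) * \<omega>_of \<gamma> + 1" using w by (simp add: left_diff_distrib)
  then have "\<lfloor>real k * \<omega>_of \<gamma>\<rfloor> \<le> \<lfloor>(real k - 1) * \<omega>_of \<gamma> + 1\<rfloor>" by (rule floor_mono)
  then show ?thesis unfolding Q_of_def by simp
qed

theorem theorem1p4:
  fixes \<gamma> l a b c :: real and f :: "real \<Rightarrow> real"
  assumes "0 < \<gamma>" and "\<gamma> < 1/2" and "\<gamma> \<notin> \<rat>"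
    and "l > 1"
    and "f \<in> S_unimodal_class \<gamma> l a b c"
  shows "\<not> collet_eckmann a b c f"
proof
  assume ce: "collet_eckmann a b c f"
  have w: "0 < \<omega>_of \<gamma>" "\<omega>_of \<gamma> < 1" using \<omega>_of_bounds assms(1,2) by auto
  have f: "normalized c f" "has_kneading_map c f (Q_of \<gamma>)" "S_unimodal l a b c f"
    using assms(5) unfolding S_unimodal_class_def unimodal_class_def by auto
  interpret S_unimodal_map l a b c f
    by unfold_locales (use assms(4) f in auto)
  \<comment> \<open>The assumed Collet--Eckmann condition itself supplies
    \<open>not_periodic\<close>.\<close>
  interpret binary_kneading_map l a b c f "Q_of \<gamma>"
    by unfold_locales
       (use f(2) Q_of_1[OF w] Q_of_le_1[OF w] collet_eckmann_imp_not_periodic[OF ce] in auto)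
  show False
    using not_collet_eckmann prefix_match_sum_superlinear[OF refl w] ce by blast
qed

end
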